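(* Consider the noisy group testing problem described in the context, and suppose that $k = o(n)$ as $n \to \infty$. For any $\delta \in (0,1)$ such that $\frac{\delta}{k} = o(1)$, Algorithm 1 (described in the context) recovers $S$ exactly with probability at least $1-3\delta$, using a random number of tests $T$ whose average satisfies \[ \mathbb{E}[T] \le \bigg(\frac{k \log \frac{n}{k}}{ I(\rho) }\bigg)(1+o(1)) + O\Big( k\log\frac{k}{\delta}\Big). \]
   Context: Noisy group testing model: there are $n$ items $\{1,\dots,n\}$, among which an unknown defective set $S$ of known cardinality $k$. A test is a vector $X \in \{0,1\}^n$ (indicating which items are pooled), and its outcome is $Y = \big(\bigvee_{j \in S} X_j\big) \oplus Z$ with $Z \sim \mathrm{Bernoulli}(\rho)$ for a fixed $\rho \in (0,\frac12)$, independent across tests, and $\oplus$ denoting addition modulo 2. Tests may be chosen adaptively (each test may depend on all previous outcomes), and the algorithm may decide when to stop, so the number of tests $T$ is random. Logarithms are natural; $H_2(\rho) = \rho\log\frac1\rho + (1-\rho)\log\frac{1}{1-\rho}$, $I(\rho) = \log 2 - H_2(\rho)$, and $D_2(a\|b) = a\log\frac ab + (1-a)\log\frac{1-a}{1-b}$. A partition (subset of items) is called empty if it contains no defective. Subroutines. (i) Repetition testing with confidence $\delta'$: a given pool is tested $\lceil \log(1/\delta')/D_2(\frac12\|\rho)\rceil$ times and the majority outcome is reported as the decision of whether the pool contains a defective. (ii) Modified noisy binary search (MNBS) with confidence $\delta'$ on an ordered array of $m$ items containing any number (possibly zero) of defectives: a procedure using noisy group tests that, with probability at least $1-\delta'$,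 returns the index of the left-most defective if one exists and returns the symbol $\phi$ if none exists, using on average at most $\frac{\log m}{I(\rho)} + O(\log\frac{1}{\delta'}) + O(\log\log m)$ tests (such a procedure exists; it is built from a noisy binary search algorithm by querying prefixes $\{1,\dots,i\}$ and appending a dummy defective). Algorithm 1 (input $n$, $k$, $\delta$): (1) Split the $n$ items arbitrarily into $k$ partitions of size $n/k$. (2) For each remaining partition, use repetition testing with confidence $\delta/k$ (repeatedly testing the whole partition as a pool) to decide whether it contains a defective. (3) For each partition declared non-empty, run MNBS with confidence $\delta/k$ and add the returned item (if not $\phi$) to the estimated defective set. Discard partitions declared empty and items declared defective, and return to step (2); terminate once all partitions are discarded, outputting the estimated defective set $\hat S$. Success means $\hat S = S$. *)

theory Defs
  imports "HOL-Probability.Probability"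
begin

definition H2 :: "real \<Rightarrow> real" where
  "H2 p = p * ln (1 / p) + (1 - p) * ln (1 / (1 - p))"

definition I_cap :: "real \<Rightarrow> real" where
  "I_cap p = ln 2 - H2 p"

definition D2 :: "real \<Rightarrow> real \<Rightarrow> real" where
  "D2 a b = a * ln (a / b) + (1 - a) * ln ((1 - a) / (1 - b))"

definition outcome :: "'i set \<Rightarrow> 'i set \<Rightarrow> bool \<Rightarrow> bool" where
  "outcome S A zt = ((\<exists>j\<in>S. j \<in> A) \<noteq> zt)"

text \<open>The noise tape: i.i.d. Bernoulli(rho) bits, the t-th test (t = 0,1,...) uses bit z t.\<close>
definition noise :: "real \<Rightarrow> (nat \<Rightarrow> bool) measure" where
  "noise \<rho> = PiM UNIV (\<lambda>_. measure_pmf (bernoulli_pmf \<rho>))"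

text \<open>A (deterministic) adaptive group-testing procedure: either stop with a result, or
  ask a pool and continue depending on the (noisy) outcome. Possibly infinite.\<close>
codatatype ('i, 'r) strat = Done (result: 'r) | Ask (pool: "'i set") (cont: "bool \<Rightarrow> ('i, 'r) strat")

primrec walk :: "'i set \<Rightarrow> (nat \<Rightarrow> bool) \<Rightarrow> ('i, 'r) strat \<Rightarrow> nat \<Rightarrow> ('i, 'r) strat" where
  "walk S z s 0 = s"
| "walk S z s (Suc t) =
     (case walk S z s t of Done r \<Rightarrow> Done r | Ask A f \<Rightarrow> f (outcome S A (z t)))"

definition strat_run :: "'i set \<Rightarrow> (nat \<Rightarrow> bool) \<Rightarrow> ('i, 'r) strat \<Rightarrow> ('r \<times> nat) option" where
  "strat_run S z s =
     (if \<exists>t. is_Done (walk S z s t)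
      then (let t = (LEAST t. is_Done (walk S z s t)) in Some (result (walk S z s t), t))
      else None)"

text \<open>B delta' xs is the MNBS procedure with confidence delta' on the ordered array xs.
  It returns (the item at) the left-most defective position, or None (= phi).\<close>
definition mnbs_spec :: "real \<Rightarrow> (real \<Rightarrow> 'i list \<Rightarrow> ('i, 'i option) strat) \<Rightarrow> bool" where
  "mnbs_spec \<rho> B \<longleftrightarrow> (\<exists>C::real. \<forall>(S::'i set) \<delta>' xs.
     finite S \<and> 0 < \<delta>' \<and> \<delta>' < 1 \<and> distinct xs \<and> xs \<noteq> [] \<longrightarrow>
       measure (noise \<rho>) {z \<in> space (noise \<rho>).
           \<exists>t. strat_run S z (B \<delta>' xs) = Some (find (\<lambda>x. x \<in> S) xs, t)} \<ge> 1 - \<delta>'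
     \<and> (\<integral>\<^sup>+ z. (case strat_run S z (B \<delta>' xs) of None \<Rightarrow> \<infinity> | Some (_, t) \<Rightarrow> ennreal (real t)) \<partial>noise \<rho>)
         \<le> ennreal (ln (real (length xs)) / I_cap \<rho>
                     + C * (ln (1 / \<delta>') + max 0 (ln (ln (real (length xs)))) + 1)))"

definition rep_count :: "real \<Rightarrow> real \<Rightarrow> nat" where
  "rep_count \<rho> \<delta>' = nat \<lceil>ln (1 / \<delta>') / D2 (1/2) \<rho>\<rceil>"

definition rep_test :: "'i set \<Rightarrow> (nat \<Rightarrow> bool) \<Rightarrow> nat \<Rightarrow> nat \<Rightarrow> 'i set \<Rightarrow> bool" where
  "rep_test S z N t0 A = (2 * card {j. j < N \<and> outcome S A (z (t0 + j))} > N)"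

text \<open>Step (3): run MNBS sequentially on the partitions declared non-empty.
  State: remaining partitions, current estimate, index of next noise bit.\<close>
fun mnbs_phase :: "'i set \<Rightarrow> (nat \<Rightarrow> bool) \<Rightarrow> (real \<Rightarrow> 'i list \<Rightarrow> ('i, 'i option) strat) \<Rightarrow> real
    \<Rightarrow> 'i list list \<Rightarrow> 'i set \<Rightarrow> nat \<Rightarrow> ('i list list \<times> 'i set \<times> nat) option" where
  "mnbs_phase S z B \<delta>' [] Sh t = Some ([], Sh, t)"
| "mnbs_phase S z B \<delta>' (p # ps) Sh t =
     (case strat_run S (\<lambda>j. z (t + j)) (B \<delta>' p) of
        None \<Rightarrow> None
      | Some (r, c) \<Rightarrow>
          (case mnbs_phase S z B \<delta>' ps (case r of None \<Rightarrow> Sh | Some x \<Rightarrow> insert x Sh) (t + c) of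
             None \<Rightarrow> None
           | Some (qs, Sh', t') \<Rightarrow>
               Some ((case r of None \<Rightarrow> p | Some x \<Rightarrow> filter (\<lambda>y. y \<noteq> x) p) # qs, Sh', t')))"

text \<open>One round: steps (2) and (3), then discarding (partitions declared empty,
  items declared defective, and partitions with no items left).\<close>
definition alg_round :: "real \<Rightarrow> 'i set \<Rightarrow> (nat \<Rightarrow> bool) \<Rightarrow> (real \<Rightarrow> 'i list \<Rightarrow> ('i, 'i option) strat)
    \<Rightarrow> real \<Rightarrow> 'i list list \<times> 'i set \<times> nat \<Rightarrow> ('i list list \<times> 'i set \<times> nat) option" where
  "alg_round \<rho> S z B \<delta>' st =
     (case st of (Ps, Sh, t) \<Rightarrow>
       (let N = rep_count \<rho> \<delta>';
            ds = map (\<lambda>i. rep_test S z N (t + i * N) (set (Ps ! i))) [0..<length Ps];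
            nonempty = map fst (filter snd (zip Ps ds))
        in case mnbs_phase S z B \<delta>' nonempty Sh (t + length Ps * N) of
             None \<Rightarrow> None
           | Some (qs, Sh', t') \<Rightarrow> Some (filter (\<lambda>q. q \<noteq> []) qs, Sh', t')))"

primrec alg_states :: "real \<Rightarrow> 'i set \<Rightarrow> (nat \<Rightarrow> bool) \<Rightarrow> (real \<Rightarrow> 'i list \<Rightarrow> ('i, 'i option) strat)
    \<Rightarrow> real \<Rightarrow> 'i list list \<Rightarrow> nat \<Rightarrow> ('i list list \<times> 'i set \<times> nat) option" where
  "alg_states \<rho> S z B \<delta>' P 0 = Some (P, {}, 0)"
| "alg_states \<rho> S z B \<delta>' P (Suc r) =
     (case alg_states \<rho> S z B \<delta>' P r of
        None \<Rightarrow> None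
      | Some st \<Rightarrow> if fst st = [] then Some st else alg_round \<rho> S z B \<delta>' st)"

definition alg1_run :: "real \<Rightarrow> (real \<Rightarrow> 'i list \<Rightarrow> ('i, 'i option) strat) \<Rightarrow> nat \<Rightarrow> real
    \<Rightarrow> 'i list list \<Rightarrow> 'i set \<Rightarrow> (nat \<Rightarrow> bool) \<Rightarrow> ('i set \<times> nat) option" where
  "alg1_run \<rho> B k \<delta> P S z =
     (let \<delta>' = \<delta> / real k; F = (\<lambda>r. alg_states \<rho> S z B \<delta>' P r) in
      if \<exists>r st. F r = Some st \<and> fst st = []
      then (case F (LEAST r. \<exists>st. F r = Some st \<and> fst st = []) of
              None \<Rightarrow> None
            | Some (_, Sh, t) \<Rightarrow> Some (Sh, t))
      else None)"

definition alg1_success_prob :: "real \<Rightarrow> (real \<Rightarrow> 'i list \<Rightarrow> ('i, 'i option) strat) \<Rightarrow> nat \<Rightarrow> real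
    \<Rightarrow> 'i list list \<Rightarrow> 'i set \<Rightarrow> real" where
  "alg1_success_prob \<rho> B k \<delta> P S =
     measure (noise \<rho>) {z \<in> space (noise \<rho>). \<exists>T. alg1_run \<rho> B k \<delta> P S z = Some (S, T)}"

definition alg1_expected_tests :: "real \<Rightarrow> (real \<Rightarrow> 'i list \<Rightarrow> ('i, 'i option) strat) \<Rightarrow> nat \<Rightarrow> real
    \<Rightarrow> 'i list list \<Rightarrow> 'i set \<Rightarrow> ennreal" where
  "alg1_expected_tests \<rho> B k \<delta> P S =
     (\<integral>\<^sup>+ z. (case alg1_run \<rho> B k \<delta> P S z of None \<Rightarrow> \<infinity> | Some (_, T) \<Rightarrow> ennreal (real T)) \<partial>noise \<rho>)"

text \<open>Step (1): P splits the items 0..n-1 into k ordered partitions of size n/k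
  (floor or ceiling when k does not divide n).\<close>
definition even_split :: "nat \<Rightarrow> nat \<Rightarrow> nat list list \<Rightarrow> bool" where
  "even_split n k P \<longleftrightarrow> length P = k \<and> distinct (concat P) \<and> set (concat P) = {..<n}
     \<and> (\<forall>p\<in>set P. length p = n div k \<or> length p = (n + k - 1) div k)"

end

theory Submission
  imports Defs "HOL-Real_Asymp.Real_Asymp"
begin

text \<open>
  Every phase of the algorithm reads the noise tape up to a stopping time, and by the strong Markov
  property the tape behind that time is fresh. Write \<open>d = \<delta> / k\<close>. Consider
  \<open>cT \<cdot> (tests so far) + cE \<cdot> [some decision was wrong] + (\<Sum>p. a + b \<cdot> s\<^sub>p)\<close>, where \<open>p\<close> ranges over the
  remaining partitions and \<open>s\<^sub>p\<close> is the number of defectives left in \<open>p\<close>. A partition without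
  defectives survives repetition testing with probability at most \<open>d\<close>, and a partition with
  defectives loses one in a round with probability about \<open>1 - d\<close>; so for suitable \<open>a\<close> and \<open>b\<close> the
  expectation of this quantity does not increase from round to round, whatever errors occurred before.
  Initially it is \<open>k (a + b)\<close>. With \<open>(cT, cE) = (1, 0)\<close> this bounds the expected number of tests by
  \<open>k (2 N + (1 + d) W) / (1 - d)\<close>, \<open>N\<close> being the number of repetitions and \<open>W\<close> the expected cost of an MNBS call;
  with \<open>(cT, cE) = (0, 1)\<close> it bounds the error probability by \<open>k d (2 + d) / (1 - d) \<le> 3 \<delta>\<close> if \<open>d \<le> 1/4\<close>.
\<close>

subsection \<open>Stopping processes on the noise tape\<close>

definition prefix_determined :: "nat \<Rightarrow> ((nat \<Rightarrow> bool) \<Rightarrow> 'c) \<Rightarrow> bool" where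
  "prefix_determined t h \<longleftrightarrow> (\<forall>z z'. (\<forall>i<t. z i = z' i) \<longrightarrow> h z = h z')"

text \<open>This plays the role of a stopping time with a result known at that time, without a
  filtration: whatever is answered at time \<open>t\<close> is decided by the first \<open>t\<close>
  bits. \<open>None\<close> stands for a run that never stops.\<close>

definition stopping :: "((nat \<Rightarrow> bool) \<Rightarrow> ('r \<times> nat) option) \<Rightarrow> bool" where
  "stopping f \<longleftrightarrow> (\<forall>z z' r t. f z = Some (r, t) \<longrightarrow> (\<forall>i<t. z i = z' i) \<longrightarrow> f z' = Some (r, t))"

text \<open>The second process sees the tape shifted by the time already spent and counts from 0
  again. Phases then compose without a global clock, which is the shape that the strong Markov
  property needs.\<close>

definition bind_proc :: "((nat \<Rightarrow> bool) \<Rightarrow> ('r \<times> nat) option) \<Rightarrow> ('r \<Rightarrow> (nat \<Rightarrow> bool) \<Rightarrow> ('s \<times> nat) option)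
    \<Rightarrow> (nat \<Rightarrow> bool) \<Rightarrow> ('s \<times> nat) option" where
  "bind_proc f g z = (case f z of None \<Rightarrow> None
     | Some (r, t) \<Rightarrow> map_option (\<lambda>(s, u). (s, t + u)) (g r (\<lambda>j. z (t + j))))"

definition return_proc :: "'r \<Rightarrow> (nat \<Rightarrow> bool) \<Rightarrow> ('r \<times> nat) option" where
  "return_proc r z = Some (r, 0)"

text \<open>Charging \<open>\<top>\<close> for a run that never stops makes every finite upper bound
  contain almost sure termination.\<close>

definition expect_proc :: "real \<Rightarrow> ((nat \<Rightarrow> bool) \<Rightarrow> ('r \<times> nat) option) \<Rightarrow> ('r \<Rightarrow> nat \<Rightarrow> ennreal) \<Rightarrow> ennreal" where
  "expect_proc \<rho> f h = (\<integral>\<^sup>+ z. (case f z of None \<Rightarrow> \<top> | Some (r, t) \<Rightarrow> h r t) \<partial>noise \<rho>)"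

lemma stoppingD: "stopping f \<Longrightarrow> f z = Some (r, t) \<Longrightarrow> (\<And>i. i < t \<Longrightarrow> z i = z' i) \<Longrightarrow> f z' = Some (r, t)"
  unfolding stopping_def by blast

lemma stopping_return_proc: "stopping (return_proc r)"
  by (simp add: stopping_def return_proc_def)

lemma stopping_bind_proc:
  assumes "stopping f" "\<And>r. stopping (g r)"
  shows "stopping (bind_proc f g)"
  unfolding stopping_def
proof (intro allI impI)
  fix z z' :: "nat \<Rightarrow> bool" and s t
  assume b: "bind_proc f g z = Some (s, t)" and eq: "\<forall>i<t. z i = z' i"
  from b obtain r t1 u where f: "f z = Some (r, t1)" and g: "g r (\<lambda>j. z (t1 + j)) = Some (s, u)"
    and t: "t = t1 + u"
    by (auto simp: bind_proc_def split: option.splits prod.splits)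
  have "f z' = Some (r, t1)" by (rule stoppingD[OF assms(1) f]) (use eq t in auto)
  moreover have "g r (\<lambda>j. z' (t1 + j)) = Some (s, u)"
    by (rule stoppingD[OF assms(2) g]) (use eq t in auto)
  ultimately show "bind_proc f g z' = Some (s, t)" by (simp add: bind_proc_def t)
qed

section \<open>The noise measure, and measurability of what reads finitely many bits\<close>

lemma space_noise [simp]: "space (noise \<rho>) = UNIV"
  by (auto simp: noise_def space_PiM)

lemma prob_space_noise: "prob_space (noise \<rho>)"
  unfolding noise_def by (intro prob_space_PiM measure_pmf.prob_space_axioms)

lemma emeasure_noise_UNIV [simp]: "emeasure (noise \<rho>) UNIV = 1"
  using prob_space.emeasure_space_1[OF prob_space_noise] by simp

lemma measurable_noise_component [measurable]: "(\<lambda>z. z i) \<in> measurable (noise \<rho>) (count_space UNIV)"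
proof -
  have "(\<lambda>z. z i) \<in> measurable (noise \<rho>) (measure_pmf (bernoulli_pmf \<rho>))"
    unfolding noise_def by (rule measurable_component_singleton) simp
  then show ?thesis by simp
qed

lemma measurable_noise_prefix [measurable]:
  "(\<lambda>z. map z [0..<t]) \<in> measurable (noise \<rho>) (count_space UNIV)"
proof -
  have "(\<lambda>z. map z [0..<t]) -` {l} \<in> sets (noise \<rho>)" for l :: "bool list"
  proof -
    have "map z [0..<t] = l \<longleftrightarrow> length l = t \<and> (\<forall>i\<in>{..<t}. z i = l ! i)" for z
      unfolding list_eq_iff_nth_eq by (auto simp del: map_eq_conv)
    then have "(\<lambda>z. map z [0..<t]) -` {l}
        = (if length l = t then {z \<in> space (noise \<rho>). \<forall>i\<in>{..<t}. z i = l ! i} else {})"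
      unfolding vimage_def by simp
    moreover have "{z \<in> space (noise \<rho>). \<forall>i\<in>{..<t}. z i = l ! i} \<in> sets (noise \<rho>)"
    proof (rule sets.sets_Collect_finite_All)
      fix i
      have "{z \<in> space (noise \<rho>). z i = l ! i} = (\<lambda>z. z i) -` {l ! i} \<inter> space (noise \<rho>)" by auto
      then show "{z \<in> space (noise \<rho>). z i = l ! i} \<in> sets (noise \<rho>)"
        using measurable_sets[OF measurable_noise_component, of "{l ! i}"] by simp
    qed simp
    ultimately show ?thesis by simp
  qed
  then show ?thesis
    by (simp add: measurable_count_space_eq2_countable)
qed

text \<open>Through this padding a function determined by the first \<open>t\<close> bits becomes a
  function on bit lists, a countable type on which every function is measurable.\<close>

definition extend :: "bool list \<Rightarrow> nat \<Rightarrow> bool" where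
  "extend l j = (j < length l \<and> l ! j)"

lemma prefix_determined_extend:
  "prefix_determined t h \<Longrightarrow> h z = h (extend (map z [0..<t]))"
  unfolding prefix_determined_def by (erule allE, erule allE, erule mp) (simp add: extend_def)

lemma measurable_prefix_determined:
  assumes "prefix_determined t h"
  shows "h \<in> measurable (noise \<rho>) (count_space UNIV)"
proof -
  have "h = (\<lambda>l. h (extend l)) \<circ> (\<lambda>z. map z [0..<t])"
    unfolding comp_def by (rule ext) (rule prefix_determined_extend[OF assms])
  moreover have "(\<lambda>l. h (extend l)) \<circ> (\<lambda>z. map z [0..<t]) \<in> measurable (noise \<rho>) (count_space UNIV)"
    by (rule measurable_comp[OF measurable_noise_prefix]) simp
  ultimately show ?thesis by metis
qed

text \<open>Agreement of two tapes is symmetric, so \<open>stopping\<close> works in both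
  directions. Hence not stopping at time \<open>t\<close> is decided by the first \<open>t\<close>
  bits as well.\<close>

lemma prefix_determined_stopping:
  assumes "stopping f"
  shows "prefix_determined t (\<lambda>z. case f z of Some (r, t') \<Rightarrow> if t' = t then Some r else None | None \<Rightarrow> None)"
  unfolding prefix_determined_def
proof (intro allI impI)
  fix z z' :: "nat \<Rightarrow> bool" assume eq: "\<forall>i<t. z i = z' i"
  have "\<forall>r. f z = Some (r, t) \<longleftrightarrow> f z' = Some (r, t)"
    using stoppingD[OF assms] eq by metis
  then show "(case f z of Some (r, t') \<Rightarrow> if t' = t then Some r else None | None \<Rightarrow> None)
    = (case f z' of Some (r, t') \<Rightarrow> if t' = t then Some r else None | None \<Rightarrow> None)"
    by (auto split: option.splits if_splits)
qed

text \<open>The process is sliced by its stopping time. Each slice depends on finitely many bits,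
  hence is measurable into the discrete space even if the result type is uncountable, and there are
  only countably many slices.\<close>

lemma measurable_stopping:
  assumes "stopping f"
  shows "f \<in> measurable (noise \<rho>) (count_space UNIV)"
proof -
  define h where "h t z = (case f z of Some (r, t') \<Rightarrow> if t' = t then Some r else None | None \<Rightarrow> None)" for t z
  have h: "h t \<in> measurable (noise \<rho>) (count_space UNIV)" for t
    unfolding h_def by (rule measurable_prefix_determined[OF prefix_determined_stopping[OF assms]])
  have some: "f -` Some ` A \<in> sets (noise \<rho>)" for A
  proof -
    have "f -` Some ` A = (\<Union>t. h t -` {Some r | r. (r, t) \<in> A} \<inter> space (noise \<rho>))"
      by (auto simp: h_def split: option.splits if_splits)
    also have "\<dots> \<in> sets (noise \<rho>)"
      by (intro sets.countable_UN image_subsetI measurable_sets[OF h]) simp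
    finally show ?thesis .
  qed
  have none: "f -` {None} \<in> sets (noise \<rho>)"
  proof -
    have "f -` {None} = space (noise \<rho>) - f -` Some ` UNIV"
      by (auto simp: notin_range_Some)
    then show ?thesis using some[of UNIV] by (metis sets.compl_sets)
  qed
  have "f -` A \<in> sets (noise \<rho>)" for A
  proof -
    have "f -` A = f -` Some ` {x. Some x \<in> A} \<union> (if None \<in> A then f -` {None} else {})"
    proof (intro set_eqI)
      fix z
      show "z \<in> f -` A \<longleftrightarrow> z \<in> f -` Some ` {x. Some x \<in> A} \<union> (if None \<in> A then f -` {None} else {})"
        by (cases "f z") auto
    qed
    moreover have "(if None \<in> A then f -` {None} else {}) \<in> sets (noise \<rho>)"
      using none by simp
    ultimately show ?thesis using some by simp
  qed
  then show ?thesis by (intro measurableI) simp_all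
qed

section \<open>Shifting and cutting the tape; the strong Markov property\<close>

lemma measurable_noise_shift [measurable]:
  "(\<lambda>z j. z (t + j)) \<in> measurable (noise \<rho>) (noise \<rho>)"
  unfolding noise_def
  by (rule measurable_PiM_single')
    (use measurable_noise_component[of _ \<rho>] in \<open>auto simp: noise_def\<close>)

text \<open>Putting the first \<open>t\<close> bits of one tape in front of an independent second
  tape reproduces the law of the noise. Later uses of independence go through this cut.\<close>

lemma nn_integral_noise_split:
  assumes [measurable]: "G \<in> borel_measurable (noise \<rho>)"
  shows "(\<integral>\<^sup>+ z. G z \<partial>noise \<rho>)
    = (\<integral>\<^sup>+ z. \<integral>\<^sup>+ w. G (comb_seq t z w) \<partial>noise \<rho> \<partial>noise \<rho>)"
proof -
  interpret M: prob_space "measure_pmf (bernoulli_pmf \<rho>)" by (rule measure_pmf.prob_space_axioms)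
  interpret S: sequence_space "measure_pmf (bernoulli_pmf \<rho>)" ..
  interpret N: prob_space "noise \<rho>" by (rule prob_space_noise)
  have c [measurable]: "(\<lambda>(z, w). comb_seq t z w) \<in> measurable (noise \<rho> \<Otimes>\<^sub>M noise \<rho>) (noise \<rho>)"
    using measurable_comb_seq[of t "measure_pmf (bernoulli_pmf \<rho>)"] by (simp add: noise_def)
  have "noise \<rho> = distr (noise \<rho> \<Otimes>\<^sub>M noise \<rho>) (noise \<rho>) (\<lambda>(z, w). comb_seq t z w)"
    using S.PiM_comb_seq[of t] by (simp add: noise_def)
  then have "(\<integral>\<^sup>+ z. G z \<partial>noise \<rho>)
      = (\<integral>\<^sup>+ z. G z \<partial>distr (noise \<rho> \<Otimes>\<^sub>M noise \<rho>) (noise \<rho>) (\<lambda>(z, w). comb_seq t z w))"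
    by simp
  also have "\<dots> = (\<integral>\<^sup>+ x. G (case x of (z, w) \<Rightarrow> comb_seq t z w) \<partial>(noise \<rho> \<Otimes>\<^sub>M noise \<rho>))"
    by (intro nn_integral_distr) auto
  also have "\<dots> = (\<integral>\<^sup>+ z. \<integral>\<^sup>+ w. G (comb_seq t z w) \<partial>noise \<rho> \<partial>noise \<rho>)"
    by (subst N.nn_integral_fst[symmetric]) auto
  finally show ?thesis .
qed

text \<open>Strong Markov property: the noise after a stopping time is fresh.\<close>

lemma nn_integral_stopping_shift:
  fixes F :: "'r \<Rightarrow> nat \<Rightarrow> (nat \<Rightarrow> bool) \<Rightarrow> ennreal"
  assumes f: "stopping f" and F [measurable]: "\<And>r t. F r t \<in> borel_measurable (noise \<rho>)"
  shows "(\<integral>\<^sup>+ z. (case f z of None \<Rightarrow> \<top> | Some (r, t) \<Rightarrow> F r t (\<lambda>j. z (t + j))) \<partial>noise \<rho>)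
    = (\<integral>\<^sup>+ z. (case f z of None \<Rightarrow> \<top> | Some (r, t) \<Rightarrow> \<integral>\<^sup>+ w. F r t w \<partial>noise \<rho>) \<partial>noise \<rho>)"
proof -
  define h where "h t z = (case f z of Some (r, t') \<Rightarrow> if t' = t then Some r else None | None \<Rightarrow> None)" for t z
  have hp: "prefix_determined t (h t)" for t
    unfolding h_def by (rule prefix_determined_stopping[OF f])
  define K where "K t F' z = (case h t z of None \<Rightarrow> 0 | Some r \<Rightarrow> F' r t (\<lambda>j. z (t + j)))"
    for t z and F' :: "'r \<Rightarrow> nat \<Rightarrow> (nat \<Rightarrow> bool) \<Rightarrow> ennreal"
  \<comment> \<open>The stopping time takes countably many values, so the integrand is a sum over
    them. Runs that never stop form a separate summand that does not depend on \<open>F'\<close> and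
    so is common to both sides.\<close>
  have KS: "(case f z of None \<Rightarrow> \<top> | Some (r, t) \<Rightarrow> F' r t (\<lambda>j. z (t + j)))
      = (case f z of None \<Rightarrow> \<top> | Some _ \<Rightarrow> 0) + (\<Sum>t. K t F' z)" for z F'
  proof (cases "f z")
    case (Some x)
    obtain r t where x: "x = (r, t)" by fastforce
    have "(\<lambda>u. K u F' z) = (\<lambda>u. if u = t then F' r t (\<lambda>j. z (t + j)) else 0)"
      using Some x by (auto simp: K_def h_def fun_eq_iff)
    then have "(\<lambda>u. K u F' z) sums (F' r t (\<lambda>j. z (t + j)))"
      using sums_single[of t "\<lambda>_. F' r t (\<lambda>j. z (t + j))"] by simp
    then show ?thesis using Some x by (simp add: sums_iff)
  qed (simp add: top_add)
  have Kl: "K t F' z = (case h t (extend (map z [0..<t])) of None \<Rightarrow> 0 | Some r \<Rightarrow> F' r t (\<lambda>j. z (t + j)))"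
    for t F' z
    unfolding K_def by (subst prefix_determined_extend[OF hp, of t z]) (rule refl)
  \<comment> \<open>Once the prefix is fixed, the slice is a constant and only a shifted
    \<open>F'\<close> remains; there are countably many prefixes.\<close>
  have Km: "K t F' \<in> borel_measurable (noise \<rho>)"
    if [measurable]: "\<And>r t. F' r t \<in> borel_measurable (noise \<rho>)" for t F'
  proof -
    have "(\<lambda>z. (\<lambda>l z. case h t (extend l) of None \<Rightarrow> 0 | Some r \<Rightarrow> F' r t (\<lambda>j. z (t + j))) (map z [0..<t]) z)
       \<in> borel_measurable (noise \<rho>)"
    proof (rule measurable_compose_countable)
      fix l
      show "(\<lambda>z. case h t (extend l) of None \<Rightarrow> 0 | Some r \<Rightarrow> F' r t (\<lambda>j. z (t + j))) \<in> borel_measurable (noise \<rho>)"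
        by (cases "h t (extend l)") (auto)
    qed measurable
    then show ?thesis using Kl[of t F'] by presburger
  qed
  have Nm: "(\<lambda>z. case f z of None \<Rightarrow> \<top> | Some _ \<Rightarrow> (0::ennreal)) \<in> borel_measurable (noise \<rho>)"
    using measurable_compose[OF measurable_stopping[OF f, of \<rho>], of "\<lambda>x. case x of None \<Rightarrow> \<top> | Some _ \<Rightarrow> (0::ennreal)" borel]
    by simp
  \<comment> \<open>\<open>F1\<close> is constant in its tape argument. This gives the right-hand
    side the same shape as the left, so one decomposition serves both.\<close>
  define F1 where "F1 r t (w :: nat \<Rightarrow> bool) = (\<integral>\<^sup>+ w. F r t w \<partial>noise \<rho>)" for r t w
  have F1: "F1 r t \<in> borel_measurable (noise \<rho>)" for r t unfolding F1_def by (rule measurable_const) simp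
  \<comment> \<open>Cut the tape at \<open>t\<close>: the slice reads only the part before the cut,
    so integrating over the part behind it replaces \<open>F\<close> by its mean.\<close>
  have eq: "(\<integral>\<^sup>+ z. K t F z \<partial>noise \<rho>) = (\<integral>\<^sup>+ z. K t F1 z \<partial>noise \<rho>)" for t
  proof -
    have hc: "h t (comb_seq t z w) = h t z" for z w
      using hp[of t] unfolding prefix_determined_def by (metis comb_seq_less)
    have "(\<integral>\<^sup>+ w. K t F (comb_seq t z w) \<partial>noise \<rho>) = K t F1 z" for z
      by (cases "h t z") (simp_all add: K_def hc F1_def comb_seq_def)
    then show ?thesis using nn_integral_noise_split[OF Km[where F' = F, OF F], of t t] by simp
  qed
  have split: "(\<integral>\<^sup>+ z. (case f z of None \<Rightarrow> \<top> | Some (r, t) \<Rightarrow> F' r t (\<lambda>j. z (t + j))) \<partial>noise \<rho>)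
     = (\<integral>\<^sup>+ z. (case f z of None \<Rightarrow> \<top> | Some _ \<Rightarrow> 0) \<partial>noise \<rho>) + (\<Sum>t. \<integral>\<^sup>+ z. K t F' z \<partial>noise \<rho>)"
    if "\<And>r t. F' r t \<in> borel_measurable (noise \<rho>)" for F'
    unfolding KS using Km[OF that] Nm
    by (subst nn_integral_add) (auto simp: nn_integral_suminf)
  have "(\<integral>\<^sup>+ z. (case f z of None \<Rightarrow> \<top> | Some (r, t) \<Rightarrow> F r t (\<lambda>j. z (t + j))) \<partial>noise \<rho>)
     = (\<integral>\<^sup>+ z. (case f z of None \<Rightarrow> \<top> | Some (r, t) \<Rightarrow> F1 r t (\<lambda>j. z (t + j))) \<partial>noise \<rho>)"
    unfolding split[where F' = F, OF F] split[where F' = F1, OF F1] eq ..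
  then show ?thesis unfolding F1_def .
qed

text \<open>The tower rule. By the strong Markov property the continuation is averaged over a fresh
  tape, and the elapsed time survives only as the offset \<open>t\<close>.\<close>

lemma expect_bind_proc:
  assumes "stopping f" "\<And>r. stopping (g r)"
  shows "expect_proc \<rho> (bind_proc f g) h = expect_proc \<rho> f (\<lambda>r t. expect_proc \<rho> (g r) (\<lambda>s u. h s (t + u)))"
proof -
  define F where "F r t w = (case g r w of None \<Rightarrow> \<top> | Some (s, u) \<Rightarrow> h s (t + u))" for r t w
  have F: "F r t \<in> borel_measurable (noise \<rho>)" for r t
    unfolding F_def
    using measurable_compose[OF measurable_stopping[OF assms(2)[of r], of \<rho>],
       of "\<lambda>x. case x of None \<Rightarrow> \<top> | Some (s, u) \<Rightarrow> h s (t + u)" borel] by simp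
  have "(case bind_proc f g z of None \<Rightarrow> \<top> | Some (s, t) \<Rightarrow> h s t)
      = (case f z of None \<Rightarrow> \<top> | Some (r, t) \<Rightarrow> F r t (\<lambda>j. z (t + j)))" for z
    by (auto simp: bind_proc_def F_def split: option.splits)
  then have "expect_proc \<rho> (bind_proc f g) h
      = (\<integral>\<^sup>+ z. (case f z of None \<Rightarrow> \<top> | Some (r, t) \<Rightarrow> F r t (\<lambda>j. z (t + j))) \<partial>noise \<rho>)"
    by (simp add: expect_proc_def)
  also have "\<dots> = expect_proc \<rho> f (\<lambda>r t. expect_proc \<rho> (g r) (\<lambda>s u. h s (t + u)))"
    unfolding nn_integral_stopping_shift[where F = F, OF assms(1) F] unfolding expect_proc_def F_def[abs_def] ..
  finally show ?thesis .
qed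

lemma expect_return_proc [simp]: "expect_proc \<rho> (return_proc r) h = h r 0"
  by (simp add: expect_proc_def return_proc_def)

lemma expect_proc_mono:
  assumes "\<And>z r t. f z = Some (r, t) \<Longrightarrow> h r t \<le> h' r t"
  shows "expect_proc \<rho> f h \<le> expect_proc \<rho> f h'"
  unfolding expect_proc_def by (rule nn_integral_mono) (auto split: option.splits intro: assms)

lemma expect_proc_add_const:
  assumes "stopping f"
  shows "expect_proc \<rho> f (\<lambda>r t. c + h r t) = c + expect_proc \<rho> f h"
proof -
  have "(\<lambda>z. case f z of None \<Rightarrow> \<top> | Some (r, t) \<Rightarrow> h r t) \<in> borel_measurable (noise \<rho>)"
    using measurable_compose[OF measurable_stopping[OF assms, of \<rho>],
       of "\<lambda>x. case x of None \<Rightarrow> \<top> | Some (r, t) \<Rightarrow> h r t" borel] by simp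
  then have "c + expect_proc \<rho> f h = (\<integral>\<^sup>+ z. c + (case f z of None \<Rightarrow> \<top> | Some (r, t) \<Rightarrow> h r t) \<partial>noise \<rho>)"
    unfolding expect_proc_def by (subst nn_integral_add) auto
  also have "\<dots> = expect_proc \<rho> f (\<lambda>r t. c + h r t)"
    unfolding expect_proc_def by (intro nn_integral_cong) (auto split: option.splits)
  finally show ?thesis by simp
qed

subsection \<open>Repetition testing\<close>

lemma nn_integral_noise_first:
  assumes "0 < \<rho>" "\<rho> < 1"
  shows "(\<integral>\<^sup>+ z. G (z 0) \<partial>noise \<rho>) = ennreal \<rho> * G True + ennreal (1 - \<rho>) * G False"
proof -
  have "distr (noise \<rho>) (measure_pmf (bernoulli_pmf \<rho>)) (\<lambda>z. z (0::nat)) = measure_pmf (bernoulli_pmf \<rho>)"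
    unfolding noise_def by (rule distr_PiM_component) (auto intro: measure_pmf.prob_space_axioms)
  then have "(\<integral>\<^sup>+ b. G b \<partial>measure_pmf (bernoulli_pmf \<rho>))
      = (\<integral>\<^sup>+ b. G b \<partial>distr (noise \<rho>) (measure_pmf (bernoulli_pmf \<rho>)) (\<lambda>z. z (0::nat)))"
    by simp
  also have "\<dots> = (\<integral>\<^sup>+ z. G (z 0) \<partial>noise \<rho>)"
    by (subst nn_integral_distr) auto
  finally show ?thesis using assms by (simp add: mult.commute)
qed

lemma nn_integral_noise_shift:
  assumes [measurable]: "H \<in> borel_measurable (noise \<rho>)"
  shows "(\<integral>\<^sup>+ z. H (\<lambda>j. z (t + j)) \<partial>noise \<rho>) = (\<integral>\<^sup>+ z. H z \<partial>noise \<rho>)"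
  by (subst nn_integral_noise_split[of _ _ t]) (simp_all add: comb_seq_def)

text \<open>Peeling off one bit at a time by a cut at 1. With exponential weights this is the moment
  generating function in the Chernoff bound.\<close>

lemma nn_integral_noise_prod:
  fixes w :: "bool \<Rightarrow> ennreal"
  assumes "0 < \<rho>" "\<rho> < 1"
  shows "(\<integral>\<^sup>+ z. (\<Prod>j<N. w (z j)) \<partial>noise \<rho>) = (ennreal \<rho> * w True + ennreal (1 - \<rho>) * w False) ^ N"
proof (induction N)
  case 0
  show ?case by simp
next
  case (Suc N)
  have w: "w \<in> borel_measurable (count_space UNIV)" by simp
  have m [measurable]: "(\<lambda>z. w (z j)) \<in> borel_measurable (noise \<rho>)" for j
    by (rule measurable_compose[OF measurable_noise_component w])
  have "(\<integral>\<^sup>+ z. (\<Prod>j<Suc N. w (z j)) \<partial>noise \<rho>)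
      = (\<integral>\<^sup>+ z. \<integral>\<^sup>+ x. (\<Prod>j<Suc N. w (comb_seq 1 z x j)) \<partial>noise \<rho> \<partial>noise \<rho>)"
    by (rule nn_integral_noise_split) simp
  also have "\<dots> = (\<integral>\<^sup>+ z. \<integral>\<^sup>+ x. w (z 0) * (\<Prod>j<N. w (x j)) \<partial>noise \<rho> \<partial>noise \<rho>)"
    by (simp add: prod.lessThan_Suc_shift comb_seq_def del: prod.lessThan_Suc)
  also have "\<dots> = (\<integral>\<^sup>+ z. w (z 0) * (ennreal \<rho> * w True + ennreal (1 - \<rho>) * w False) ^ N \<partial>noise \<rho>)"
    by (subst nn_integral_cmult) (simp_all add: Suc.IH)
  also have "\<dots> = (ennreal \<rho> * w True + ennreal (1 - \<rho>) * w False) ^ Suc N"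
    by (subst nn_integral_multc) (simp_all add: nn_integral_noise_first[OF assms, of w])
  finally show ?case .
qed

text \<open>Kept general in \<open>G\<close> and \<open>q\<close> so that both the majority event
  and \<open>rep_test\<close> are instances.\<close>

lemma prefix_determined_window:
  "prefix_determined (t + N) (\<lambda>z. G {j. j < N \<and> q (z (t + j))})"
  unfolding prefix_determined_def
proof (intro allI impI)
  fix z z' :: "nat \<Rightarrow> bool" assume "\<forall>i<t + N. z i = z' i"
  then have "{j. j < N \<and> q (z (t + j))} = {j. j < N \<and> q (z' (t + j))}" by auto
  then show "G {j. j < N \<and> q (z (t + j))} = G {j. j < N \<and> q (z' (t + j))}" by simp
qed

lemma sets_majority:
  "{z. N \<le> 2 * card {j. j < N \<and> z (t + j)}} \<in> sets (noise \<rho>)"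
  using measurable_prefix_determined[OF prefix_determined_window[of t N "\<lambda>X. N \<le> 2 * card X" "\<lambda>b. b"], of \<rho>]
  by (simp add: pred_def)

lemma D2_half:
  assumes "0 < \<rho>" "\<rho> < 1"
  shows "D2 (1/2) \<rho> = - ln 2 - (ln \<rho> + ln (1 - \<rho>)) / 2"
proof -
  have "ln (1/2 / x) = - ln 2 - ln x" if "0 < x" for x :: real
    using that ln_div[of "1/2" x] by (simp add: ln_div)
  from this[of \<rho>] this[of "1 - \<rho>"] show ?thesis
    using assms by (simp add: D2_def field_simps)
qed

text \<open>Chernoff bound with the tilt \<open>c\<close> that makes the two outcomes equally likely.\<close>

lemma emeasure_majority_flipped:
  assumes \<rho>: "0 < \<rho>" "\<rho> < 1/2"
  shows "emeasure (noise \<rho>) {z. N \<le> 2 * card {j. j < N \<and> z (t + j)}} \<le> ennreal (exp (- (real N * D2 (1/2) \<rho>)))"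
proof -
  define c where "c = (ln (1 - \<rho>) - ln \<rho>) / 2"
  define w where "w b = ennreal (exp (if b then c else - c))" for b
  have c: "0 \<le> c" using \<rho> by (simp add: c_def)
  \<comment> \<open>On this event at least half of the bits are flipped, so the total exponent is
    nonnegative and the product is at least 1.\<close>
  have pw: "indicator {z. N \<le> 2 * card {j. j < N \<and> z (t + j)}} z \<le> (\<Prod>j<N. w (z (t + j)))" for z
  proof (cases "N \<le> 2 * card {j. j < N \<and> z (t + j)}")
    case True
    have s: "(\<Sum>j<N. if z (t + j) then c else - c) = c * (2 * real (card {j. j < N \<and> z (t + j)}) - real N)"
    proof -
      have "(\<Sum>j<N. if z (t + j) then c else - c) = (\<Sum>j<N. 2 * c * (if z (t + j) then 1 else 0) - c)"
        by (intro sum.cong) auto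
      also have "\<dots> = 2 * c * (\<Sum>j<N. if z (t + j) then 1 else 0) - N * c"
        by (simp add: sum_subtractf sum_distrib_left)
      also have "(\<Sum>j<N. if z (t + j) then 1 else (0::real)) = real (card {j. j < N \<and> z (t + j)})"
        by (subst sum.If_cases) (simp_all add: Int_def)
      finally show ?thesis by (simp add: algebra_simps)
    qed
    have "(\<Prod>j<N. w (z (t + j))) = ennreal (exp (\<Sum>j<N. if z (t + j) then c else - c))"
      by (simp add: w_def prod_ennreal exp_sum)
    moreover have "0 \<le> (\<Sum>j<N. if z (t + j) then c else - c)"
      unfolding s using True c by (intro mult_nonneg_nonneg) linarith+
    ultimately show ?thesis using True by (simp add: ennreal_leI)
  qed simp
  have w: "w \<in> borel_measurable (count_space UNIV)" by simp
  have m [measurable]: "(\<lambda>z. w (z j)) \<in> borel_measurable (noise \<rho>)" for j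
    by (rule measurable_compose[OF measurable_noise_component w])
  have "emeasure (noise \<rho>) {z. N \<le> 2 * card {j. j < N \<and> z (t + j)}}
      = (\<integral>\<^sup>+ z. indicator {z. N \<le> 2 * card {j. j < N \<and> z (t + j)}} z \<partial>noise \<rho>)"
    by (rule nn_integral_indicator[symmetric]) (rule sets_majority)
  also have "\<dots> \<le> (\<integral>\<^sup>+ z. (\<Prod>j<N. w (z (t + j))) \<partial>noise \<rho>)"
    by (rule nn_integral_mono) (rule pw)
  also have "\<dots> = (\<integral>\<^sup>+ z. (\<Prod>j<N. w (z j)) \<partial>noise \<rho>)"
    by (rule nn_integral_noise_shift[of "\<lambda>z. \<Prod>j<N. w (z j)"]) simp
  also have "\<dots> = (ennreal \<rho> * w True + ennreal (1 - \<rho>) * w False) ^ N"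
    using \<rho> by (intro nn_integral_noise_prod) auto
  also have "ennreal \<rho> * w True + ennreal (1 - \<rho>) * w False = ennreal (\<rho> * exp c + (1 - \<rho>) * exp (- c))"
    using \<rho> by (simp add: w_def ennreal_mult ennreal_plus)
  \<comment> \<open>With this tilt both summands equal the geometric mean of \<rho> and 1 - \<rho>,
    which is \<open>exp d\<close>.\<close>
  also have "\<rho> * exp c + (1 - \<rho>) * exp (- c) = exp (- D2 (1/2) \<rho>)"
  proof -
    define d where "d = (ln \<rho> + ln (1 - \<rho>)) / 2"
    have "\<rho> * exp c = exp (ln \<rho> + c)" using \<rho> by (simp add: exp_add)
    moreover have "ln \<rho> + c = d" by (simp add: c_def d_def field_simps)
    moreover have "(1 - \<rho>) * exp (- c) = exp (ln (1 - \<rho>) - c)" using \<rho> by (simp add: exp_diff exp_minus field_simps)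
    moreover have "ln (1 - \<rho>) - c = d" by (simp add: c_def d_def field_simps)
    moreover have "- D2 (1/2) \<rho> = ln 2 + d" using \<rho> by (simp add: D2_half d_def)
    moreover have "exp (ln 2 + d) = 2 * exp d" by (simp add: exp_add)
    ultimately show ?thesis by simp
  qed
  also have "ennreal (exp (- D2 (1/2) \<rho>)) ^ N = ennreal (exp (- (real N * D2 (1/2) \<rho>)))"
    by (simp add: ennreal_power exp_of_nat_mult[symmetric])
  finally show ?thesis .
qed

text \<open>The divergence is -1/2 times the logarithm of 4 \<rho> (1 - \<rho>), and this product is
  below 1 because \<rho> differs from 1/2.\<close>

lemma D2_half_pos:
  assumes "0 < \<rho>" "\<rho> < 1/2"
  shows "0 < D2 (1/2) \<rho>"
proof -
  have "\<rho> * (1 - \<rho>) < 1/4"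
  proof -
    have "0 < (1/2 - \<rho>) * (1/2 - \<rho>)" using assms by (intro mult_pos_pos) auto
    then show ?thesis by (simp add: algebra_simps)
  qed
  then have "ln (\<rho> * (1 - \<rho>)) < ln (1/4)" using assms by (subst ln_less_cancel_iff) auto
  also have "ln (1/4::real) = - (2 * ln 2)"
    using ln_realpow[of "2::real" 2] by (simp add: ln_div)
  finally show ?thesis using assms by (simp add: D2_half ln_mult)
qed

lemma rep_count_bound:
  assumes "0 < \<rho>" "\<rho> < 1/2" "0 < d"
  shows "exp (- (real (rep_count \<rho> d) * D2 (1/2) \<rho>)) \<le> d"
proof -
  have D: "0 < D2 (1/2) \<rho>" using assms by (intro D2_half_pos)
  have "ln (1 / d) / D2 (1/2) \<rho> \<le> real (rep_count \<rho> d)"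
    unfolding rep_count_def by linarith
  then have "ln (1 / d) \<le> real (rep_count \<rho> d) * D2 (1/2) \<rho>"
    using D by (simp add: field_simps)
  then have "exp (- (real (rep_count \<rho> d) * D2 (1/2) \<rho>)) \<le> exp (ln d)"
    using assms by (intro iffD2[OF exp_le_cancel_iff]) (simp add: ln_div)
  then show ?thesis using assms by simp
qed

lemma prefix_determined_rep_test:
  "prefix_determined (t + N) (\<lambda>z. rep_test S z N t A)"
  unfolding rep_test_def by (rule prefix_determined_window)

text \<open>In a pool without defectives the outcome is the noise bit itself, so a positive majority
  means that most bits were flipped.\<close>

lemma rep_test_false_alarm:
  assumes "0 < \<rho>" "\<rho> < 1/2" "0 < d" "A \<inter> S = {}"
  shows "emeasure (noise \<rho>) {z. rep_test S z (rep_count \<rho> d) t A} \<le> ennreal d"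
proof -
  let ?N = "rep_count \<rho> d"
  have "\<not> (\<exists>j\<in>S. j \<in> A)" using assms(4) by blast
  then have o: "outcome S A b = b" for b by (simp add: outcome_def)
  have "{z. rep_test S z ?N t A} \<subseteq> {z. ?N \<le> 2 * card {j. j < ?N \<and> z (t + j)}}"
    unfolding rep_test_def o by (intro Collect_mono) simp
  from emeasure_mono[OF this sets_majority] show ?thesis
    by (rule order_trans)
      (rule order_trans[OF emeasure_majority_flipped[OF assms(1,2)] ennreal_leI[OF rep_count_bound[OF assms(1-3)]]])
qed

text \<open>In a pool with a defective the negative outcomes are the flipped bits.
  \<open>rep_test\<close> asks for a strict majority, so a tie is also a miss; this is why the
  majority event is bounded in its non-strict form.\<close>

lemma rep_test_miss:
  assumes "0 < \<rho>" "\<rho> < 1/2" "0 < d" "A \<inter> S \<noteq> {}"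
  shows "emeasure (noise \<rho>) {z. \<not> rep_test S z (rep_count \<rho> d) t A} \<le> ennreal d"
proof -
  let ?N = "rep_count \<rho> d"
  have "\<exists>j\<in>S. j \<in> A" using assms(4) by blast
  then have o: "outcome S A b = (\<not> b)" for b by (simp add: outcome_def)
  have "card {j. j < ?N \<and> z (t + j)} + card {j. j < ?N \<and> \<not> z (t + j)} = ?N" for z :: "nat \<Rightarrow> bool"
  proof -
    have "card ({j. j < ?N \<and> z (t + j)} \<union> {j. j < ?N \<and> \<not> z (t + j)})
        = card {j. j < ?N \<and> z (t + j)} + card {j. j < ?N \<and> \<not> z (t + j)}"
      by (rule card_Un_disjoint) auto
    moreover have "{j. j < ?N \<and> z (t + j)} \<union> {j. j < ?N \<and> \<not> z (t + j)} = {..<?N}" by auto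
    ultimately show ?thesis by simp
  qed
  note count = this
  have "?N \<le> 2 * card {j. j < ?N \<and> z (t + j)}" if "\<not> rep_test S z ?N t A" for z
    using that count[of z] unfolding rep_test_def o by linarith
  then have "{z. \<not> rep_test S z ?N t A} \<subseteq> {z. ?N \<le> 2 * card {j. j < ?N \<and> z (t + j)}}"
    by blast
  from emeasure_mono[OF this sets_majority] show ?thesis
    by (rule order_trans)
      (rule order_trans[OF emeasure_majority_flipped[OF assms(1,2)] ennreal_leI[OF rep_count_bound[OF assms(1-3)]]])
qed

subsection \<open>The algorithm as a stopping process\<close>

lemma walk_cong: "(\<And>i. i < t \<Longrightarrow> z i = z' i) \<Longrightarrow> walk S z s t = walk S z' s t"
proof (induction t)
  case (Suc t)
  have "walk S z s t = walk S z' s t" by (rule Suc.IH) (simp add: Suc.prems)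
  then show ?case using Suc.prems[OF lessI] by (simp split: strat.split)
qed simp

lemma strat_run_eq_Some_iff:
  "strat_run S z s = Some (r, t) \<longleftrightarrow>
     is_Done (walk S z s t) \<and> (\<forall>u<t. \<not> is_Done (walk S z s u)) \<and> r = result (walk S z s t)"
proof
  assume "strat_run S z s = Some (r, t)"
  then have ex: "\<exists>t. is_Done (walk S z s t)" and t: "t = (LEAST t. is_Done (walk S z s t))"
    and r: "r = result (walk S z s t)"
    by (auto simp: strat_run_def Let_def split: if_splits)
  show "is_Done (walk S z s t) \<and> (\<forall>u<t. \<not> is_Done (walk S z s u)) \<and> r = result (walk S z s t)"
    using LeastI_ex[OF ex] not_less_Least[of _ "\<lambda>t. is_Done (walk S z s t)"] t r by blast
next
  assume *: "is_Done (walk S z s t) \<and> (\<forall>u<t. \<not> is_Done (walk S z s u)) \<and> r = result (walk S z s t)"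
  then have "(LEAST t. is_Done (walk S z s t)) = t"
    by (intro Least_equality) (auto simp: not_less[symmetric])
  with * show "strat_run S z s = Some (r, t)" unfolding strat_run_def Let_def by auto
qed

lemma stopping_strat_run: "stopping (\<lambda>z. strat_run S z s)"
  unfolding stopping_def
proof (intro allI impI)
  fix z z' :: "nat \<Rightarrow> bool" and r t
  assume run: "strat_run S z s = Some (r, t)" and eq: "\<forall>i<t. z i = z' i"
  have "walk S z' s u = walk S z s u" if "u \<le> t" for u
    by (rule walk_cong) (use eq that in auto)
  then show "strat_run S z' s = Some (r, t)"
    using run unfolding strat_run_eq_Some_iff by simp
qed

lemma nn_integral_noise_const_add:
  "f \<in> borel_measurable (noise \<rho>) \<Longrightarrow> (\<integral>\<^sup>+ z. c + f z \<partial>noise \<rho>) = c + (\<integral>\<^sup>+ z. f z \<partial>noise \<rho>)"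
  by (subst nn_integral_add) simp_all

lemma borel_measurable_noise_linear:
  fixes f g :: "_ \<Rightarrow> ennreal"
  assumes [measurable]: "f \<in> borel_measurable (noise \<rho>)" "g \<in> borel_measurable (noise \<rho>)"
  shows "(\<lambda>z. c * f z + e * g z) \<in> borel_measurable (noise \<rho>)"
  by measurable

lemma nn_integral_noise_linear:
  assumes [measurable]: "f \<in> borel_measurable (noise \<rho>)" "g \<in> borel_measurable (noise \<rho>)"
  shows "(\<integral>\<^sup>+ z. c * f z + e * g z \<partial>noise \<rho>)
    = c * (\<integral>\<^sup>+ z. f z \<partial>noise \<rho>) + e * (\<integral>\<^sup>+ z. g z \<partial>noise \<rho>)"
  by (subst nn_integral_add, measurable) (subst nn_integral_cmult, measurable)+

definition add_item :: "'i option \<Rightarrow> 'i set \<Rightarrow> 'i set" where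
  "add_item r Sh = (case r of None \<Rightarrow> Sh | Some x \<Rightarrow> insert x Sh)"

definition drop_item :: "'i option \<Rightarrow> 'i list \<Rightarrow> 'i list" where
  "drop_item r p = (case r of None \<Rightarrow> p | Some x \<Rightarrow> filter (\<lambda>y. y \<noteq> x) p)"

text \<open>\<open>d\<close> is the confidence of the subroutines, \<open>m\<close> bounds the partition sizes and \<open>W\<close> the expected
  number of tests of one MNBS call.\<close>

locale noisy_testing =
  fixes \<rho> :: real and S :: "'i set" and B :: "real \<Rightarrow> 'i list \<Rightarrow> ('i, 'i option) strat"
    and d :: real and m :: nat and W :: real
  assumes rho: "0 < \<rho>" "\<rho> < 1/2"
    and finite_S: "finite S"
    and d: "0 < d" "d < 1"
    and mnbs_correct: "\<And>xs. distinct xs \<Longrightarrow> xs \<noteq> [] \<Longrightarrow>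
      1 - d \<le> measure (noise \<rho>) {z \<in> space (noise \<rho>).
         \<exists>t. strat_run S z (B d xs) = Some (find (\<lambda>x. x \<in> S) xs, t)}"
    and mnbs_cost: "\<And>xs. distinct xs \<Longrightarrow> xs \<noteq> [] \<Longrightarrow> length xs \<le> m \<Longrightarrow>
      (\<integral>\<^sup>+ z. (case strat_run S z (B d xs) of None \<Rightarrow> \<infinity> | Some (_, t) \<Rightarrow> ennreal (real t)) \<partial>noise \<rho>)
        \<le> ennreal W"
begin

abbreviation reps :: nat where
  "reps \<equiv> rep_count \<rho> d"

abbreviation mnbs :: "'i list \<Rightarrow> (nat \<Rightarrow> bool) \<Rightarrow> ('i option \<times> nat) option" where
  "mnbs p \<equiv> \<lambda>z. strat_run S z (B d p)"

text \<open>A clock-free version of the MNBS phase: every call reads its tape from position 0 and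
  \<open>bind_proc\<close> does the shifting.\<close>

primrec mnbs_proc :: "'i list list \<Rightarrow> 'i set \<Rightarrow> (nat \<Rightarrow> bool) \<Rightarrow> (('i list list \<times> 'i set) \<times> nat) option" where
  "mnbs_proc [] Sh = return_proc ([], Sh)"
| "mnbs_proc (p # ps) Sh = bind_proc (mnbs p) (\<lambda>r. bind_proc (mnbs_proc ps (add_item r Sh))
     (\<lambda>x. return_proc (drop_item r p # fst x, snd x)))"

text \<open>Positions are filtered rather than partitions, because the window of noise bits that a
  test reads depends on the position. The windows have fixed length, so all tests of a round form
  one process with a deterministic stopping time.\<close>

definition flagged :: "'i list list \<Rightarrow> (nat \<Rightarrow> bool) \<Rightarrow> 'i list list" where
  "flagged Ps z = map ((!) Ps) (filter (\<lambda>i. rep_test S z reps (i * reps) (set (Ps ! i))) [0..<length Ps])"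

definition round_proc :: "'i list list \<Rightarrow> 'i set \<Rightarrow> (nat \<Rightarrow> bool) \<Rightarrow> (('i list list \<times> 'i set) \<times> nat) option" where
  "round_proc Ps Sh = bind_proc (\<lambda>z. Some (flagged Ps z, length Ps * reps))
     (\<lambda>fs. bind_proc (mnbs_proc fs Sh) (\<lambda>x. return_proc (filter (\<lambda>q. q \<noteq> []) (fst x), snd x)))"

primrec state_proc :: "'i list list \<Rightarrow> nat \<Rightarrow> (nat \<Rightarrow> bool) \<Rightarrow> (('i list list \<times> 'i set) \<times> nat) option" where
  "state_proc P 0 = return_proc (P, {})"
| "state_proc P (Suc r) = bind_proc (state_proc P r)
     (\<lambda>x. if fst x = [] then return_proc x else round_proc (fst x) (snd x))"

section \<open>Agreement of the algorithm on the global clock with the clock-free processes\<close>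

lemma mnbs_phase_eq:
  "mnbs_phase S z B d ps Sh t
     = map_option (\<lambda>(x, u). (fst x, snd x, t + u)) (mnbs_proc ps Sh (\<lambda>j. z (t + j)))"
proof (induction ps arbitrary: Sh t)
  case Nil
  show ?case by (simp add: return_proc_def)
next
  case (Cons p ps)
  show ?case
  proof (cases "strat_run S (\<lambda>j. z (t + j)) (B d p)")
    case None
    then show ?thesis by (simp add: bind_proc_def)
  next
    case (Some x)
    obtain r c where x: "x = (r, c)" by fastforce
    show ?thesis
    proof (cases "mnbs_proc ps (add_item r Sh) (\<lambda>j. z (t + c + j))")
      case None
      then show ?thesis using Some x Cons.IH[of "add_item r Sh" "t + c"]
        by (simp add: bind_proc_def add_item_def add.assoc)
    next
      case (Some y)
      obtain qs Sh' u where y: "y = ((qs, Sh'), u)" by (metis prod.exhaust)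
      show ?thesis using \<open>strat_run S (\<lambda>j. z (t + j)) (B d p) = Some x\<close> x Some y Cons.IH[of "add_item r Sh" "t + c"]
        by (simp add: bind_proc_def add_item_def drop_item_def return_proc_def add.assoc)
    qed
  qed
qed

lemma rep_test_shift: "rep_test S (\<lambda>j. z (t + j)) N t' A = rep_test S z N (t + t') A"
  by (simp add: rep_test_def add.assoc)

lemma alg_round_eq:
  "alg_round \<rho> S z B d (Ps, Sh, t)
     = map_option (\<lambda>(x, u). (fst x, snd x, t + u)) (round_proc Ps Sh (\<lambda>j. z (t + j)))"
proof -
  let ?g = "\<lambda>i. rep_test S z reps (t + i * reps) (set (Ps ! i))"
  have "zip Ps (map ?g [0..<length Ps]) = map (\<lambda>i. (Ps ! i, ?g i)) [0..<length Ps]"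
    by (rule nth_equalityI) auto
  then have "map fst (filter snd (zip Ps (map ?g [0..<length Ps]))) = flagged Ps (\<lambda>j. z (t + j))"
    by (simp add: flagged_def rep_test_shift filter_map comp_def)
  then show ?thesis
    by (auto simp: alg_round_def Let_def mnbs_phase_eq round_proc_def bind_proc_def return_proc_def
        add.assoc option.map_comp comp_def split: option.splits prod.splits)
qed

lemma alg_states_eq:
  "alg_states \<rho> S z B d P r = map_option (\<lambda>(x, t). (fst x, snd x, t)) (state_proc P r z)"
proof (induction r)
  case 0
  show ?case by (simp add: return_proc_def)
next
  case (Suc r)
  show ?case
  proof (cases "state_proc P r z")
    case None
    then show ?thesis using Suc by (simp add: bind_proc_def)
  next
    case (Some y)
    obtain Ps Sh t where y: "y = ((Ps, Sh), t)" by (metis prod.exhaust)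
    show ?thesis
    proof (cases "Ps = []")
      case True
      then show ?thesis using Suc Some y by (simp add: bind_proc_def return_proc_def)
    next
      case False
      then show ?thesis using Suc Some y
        by (simp add: bind_proc_def alg_round_eq option.map_comp comp_def case_prod_unfold)
    qed
  qed
qed

section \<open>The phases are stopping processes\<close>

lemma stopping_mnbs_proc: "stopping (mnbs_proc ps Sh)"
  by (induction ps arbitrary: Sh)
    (simp_all add: stopping_return_proc stopping_bind_proc stopping_strat_run)

lemma stopping_flagged: "stopping (\<lambda>z. Some (flagged Ps z, length Ps * reps))"
  unfolding stopping_def
proof (intro allI impI)
  fix z z' :: "nat \<Rightarrow> bool" and r t
  assume "Some (flagged Ps z, length Ps * reps) = Some (r, t)" and eq: "\<forall>i<t. z i = z' i"
  then have r: "r = flagged Ps z" and t: "t = length Ps * reps" by auto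
  have "rep_test S z reps (i * reps) A = rep_test S z' reps (i * reps) A" if "i < length Ps" for i A
  proof -
    \<comment> \<open>Window \<open>i\<close> ends at \<open>(i + 1) * reps\<close>, hence inside
      the bits that the round has read.\<close>
    have "i * reps + reps \<le> length Ps * reps"
      using mult_le_mono1[of "Suc i" "length Ps" reps] that by simp
    then have "\<forall>j<i * reps + reps. z j = z' j" using eq t by auto
    then show ?thesis using prefix_determined_rep_test[of "i * reps" reps S A]
      unfolding prefix_determined_def by blast
  qed
  then have "flagged Ps z = flagged Ps z'"
    unfolding flagged_def by (intro arg_cong[where f = "map ((!) Ps)"] filter_cong) auto
  then show "Some (flagged Ps z', length Ps * reps) = Some (r, t)" using r t by simp
qed

lemma stopping_round_proc: "stopping (round_proc Ps Sh)"
  unfolding round_proc_def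
  by (intro stopping_bind_proc stopping_flagged stopping_mnbs_proc stopping_return_proc)

lemma stopping_state_proc: "stopping (state_proc P r)"
  by (induction r) (auto intro!: stopping_return_proc stopping_bind_proc stopping_round_proc)

subsection \<open>A linear potential\<close>

text \<open>These are the conditions under which the locale guarantees both correctness and cost of
  an MNBS call. They are invariant from round to round: partitions only shrink, and empty ones are
  discarded.\<close>

definition proper :: "'i list \<Rightarrow> bool" where
  "proper p \<longleftrightarrow> p \<noteq> [] \<and> distinct p \<and> length p \<le> m"

lemma proper_drop_item: "proper p \<Longrightarrow> drop_item r p = [] \<or> proper (drop_item r p)"
  by (auto simp: proper_def drop_item_def split: option.splits intro: order_trans[OF length_filter_le])

lemma mnbs_proc_proper:
  "mnbs_proc ps Sh z = Some (x, t) \<Longrightarrow> \<forall>p\<in>set ps. proper p \<Longrightarrow> \<forall>q\<in>set (fst x). q = [] \<or> proper q"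
proof (induction ps arbitrary: Sh z x t)
  case Nil
  then show ?case by (auto simp: return_proc_def)
next
  case (Cons p ps)
  from Cons.prems(1) obtain r c y u where
    "mnbs_proc ps (add_item r Sh) (\<lambda>j. z (c + j)) = Some (y, u)" "x = (drop_item r p # fst y, snd y)"
    by (auto simp: bind_proc_def return_proc_def split: option.splits prod.splits)
  with Cons.IH[of "add_item r Sh" "\<lambda>j. z (c + j)" y u] Cons.prems(2) proper_drop_item[of p r]
  show ?case by auto
qed

lemma set_flagged: "set (flagged Ps z) \<subseteq> set Ps"
  by (auto simp: flagged_def)

lemma round_proc_proper:
  assumes "round_proc Ps Sh z = Some (x, t)" "\<forall>p\<in>set Ps. proper p"
  shows "\<forall>q\<in>set (fst x). proper q"
proof -
  from assms(1) obtain y u where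
    y: "mnbs_proc (flagged Ps z) Sh (\<lambda>j. z (length Ps * reps + j)) = Some (y, u)"
    and x: "x = (filter (\<lambda>q. q \<noteq> []) (fst y), snd y)"
    by (auto simp: round_proc_def bind_proc_def return_proc_def split: option.splits prod.splits)
  have "\<forall>q\<in>set (fst y). q = [] \<or> proper q"
    by (rule mnbs_proc_proper[OF y]) (use assms(2) set_flagged in blast)
  then show ?thesis using x by auto
qed

lemma state_proc_proper:
  "state_proc P r z = Some (x, t) \<Longrightarrow> \<forall>p\<in>set P. proper p \<Longrightarrow> \<forall>q\<in>set (fst x). proper q"
proof (induction r arbitrary: x t)
  case 0
  then show ?case by (auto simp: return_proc_def)
next
  case (Suc r)
  from Suc.prems(1) obtain y c u where y: "state_proc P r z = Some (y, c)"
    and x: "(if fst y = [] then return_proc y else round_proc (fst y) (snd y)) (\<lambda>j. z (c + j)) = Some (x, u)"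
    by (auto simp: bind_proc_def split: option.splits prod.splits)
  from Suc.IH[OF y Suc.prems(2)] x round_proc_proper[of "fst y" "snd y" "\<lambda>j. z (c + j)" x u]
  show ?case by (auto simp: return_proc_def split: if_splits)
qed

definition defects :: "'i list \<Rightarrow> nat" where
  "defects p = card (set p \<inter> S)"

text \<open>With \<open>U\<close> the items still in play, damage is either a false member of the
  estimate or a defective that is neither found nor in play. For empty \<open>U\<close>, the absence
  of damage is exactly \<open>Sh = S\<close>.\<close>

definition bad :: "'i set \<Rightarrow> 'i set \<Rightarrow> bool" where
  "bad Sh U \<longleftrightarrow> \<not> (Sh \<subseteq> S \<and> S \<subseteq> Sh \<union> U)"

lemma defects_eq_0_iff: "defects p = 0 \<longleftrightarrow> set p \<inter> S = {}"
  by (simp add: defects_def)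

lemma defects_drop_item_le: "defects (drop_item r p) \<le> defects p"
  unfolding defects_def by (rule card_mono) (auto simp: drop_item_def split: option.splits)

text \<open>A correct answer moves one defective of \<open>p\<close> from the items in play into the
  estimate, so nothing is lost. The truncated subtraction covers the answer \<open>None\<close>,
  where \<open>p\<close> has no defective.\<close>

lemma drop_find:
  assumes "r = find (\<lambda>x. x \<in> S) p"
  shows "defects (drop_item r p) = defects p - 1"
    and "bad (add_item r Sh) (set (drop_item r p) \<union> R) \<Longrightarrow> bad Sh (set p \<union> R)"
proof -
  have "defects (drop_item r p) = defects p - 1
    \<and> (bad (add_item r Sh) (set (drop_item r p) \<union> R) \<longrightarrow> bad Sh (set p \<union> R))"
  proof (cases r)
    case None
    then have "set p \<inter> S = {}" using assms by (auto simp: find_None_iff eq_commute[of None])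
    then show ?thesis using None by (simp add: drop_item_def add_item_def defects_def)
  next
    case (Some x)
    then have x: "x \<in> set p \<inter> S" using assms find_Some_iff[of "\<lambda>x. x \<in> S" p x] by auto
    have "set (drop_item r p) \<inter> S = set p \<inter> S - {x}" using Some by (auto simp: drop_item_def)
    then have "defects (drop_item r p) = defects p - 1" using x by (simp add: defects_def)
    moreover have "bad (add_item r Sh) (set (drop_item r p) \<union> R) \<longrightarrow> bad Sh (set p \<union> R)"
      using x Some by (auto simp: bad_def add_item_def drop_item_def)
    ultimately show ?thesis by simp
  qed
  then show "defects (drop_item r p) = defects p - 1"
    and "bad (add_item r Sh) (set (drop_item r p) \<union> R) \<Longrightarrow> bad Sh (set p \<union> R)" by auto
qed


definition potential :: "ennreal \<Rightarrow> ennreal \<Rightarrow> 'i list list \<Rightarrow> ennreal" where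
  "potential a b ps = (\<Sum>p\<leftarrow>ps. a + b * of_nat (defects p))"

definition items :: "'i list list \<Rightarrow> 'i set" where
  "items ps = \<Union> (set ` set ps)"

text \<open>\<open>R\<close> holds the items of partitions outside the list, which lets the bound below be proved by
  induction along the MNBS phase.\<close>

definition val :: "ennreal \<Rightarrow> ennreal \<Rightarrow> ennreal \<Rightarrow> ennreal \<Rightarrow> 'i set \<Rightarrow> 'i list list \<times> 'i set \<Rightarrow> nat \<Rightarrow> ennreal" where
  "val cT cE a b R x t
     = cT * of_nat t + cE * of_bool (bad (snd x) (items (fst x) \<union> R)) + potential a b (fst x)"

text \<open>The charge of one MNBS call together with the potential it leaves behind. With a
  defective present, a wrong answer may fail to remove one, hence the extra
  \<open>b * ennreal d\<close>; with none present, the count stays 0 whatever is answered.\<close>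

definition call_cost :: "ennreal \<Rightarrow> ennreal \<Rightarrow> ennreal \<Rightarrow> ennreal \<Rightarrow> 'i list \<Rightarrow> ennreal" where
  "call_cost cT cE a b p = cT * ennreal W + cE * ennreal d
     + (if defects p = 0 then a else b * ennreal d + (a + b * of_nat (defects p - 1)))"

lemma emeasure_mnbs_error:
  assumes "proper p"
  shows "emeasure (noise \<rho>) {z. \<not> (\<exists>t. mnbs p z = Some (find (\<lambda>x. x \<in> S) p, t))} \<le> ennreal d"
proof -
  interpret N: prob_space "noise \<rho>" by (rule prob_space_noise)
  define G where "G = {z. \<exists>t. mnbs p z = Some (find (\<lambda>x. x \<in> S) p, t)}"
  have "G = mnbs p -` {Some (find (\<lambda>x. x \<in> S) p, t) | t. True} \<inter> space (noise \<rho>)"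
    by (auto simp: G_def)
  also have "\<dots> \<in> sets (noise \<rho>)"
    by (rule measurable_sets[OF measurable_stopping[OF stopping_strat_run]]) simp
  finally have G: "G \<in> sets (noise \<rho>)" .
  have "1 - d \<le> measure (noise \<rho>) G"
    using mnbs_correct[of p] assms by (simp add: proper_def G_def)
  then have "measure (noise \<rho>) (space (noise \<rho>) - G) \<le> d"
    using N.prob_compl[OF G] by simp
  moreover have "{z. \<not> (\<exists>t. mnbs p z = Some (find (\<lambda>x. x \<in> S) p, t))} = space (noise \<rho>) - G"
    by (auto simp: G_def)
  ultimately show ?thesis by (simp add: N.emeasure_eq_measure ennreal_leI)
qed

text \<open>A correct answer does no damage and lowers the count as it should; a wrong one costs at
  most a fixed penalty and has probability at most \<open>d\<close>.\<close>

lemma expect_mnbs_le: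
  assumes p: "proper p"
  shows "expect_proc \<rho> (mnbs p) (\<lambda>r t. cT * of_nat t
      + cE * of_bool (bad (add_item r Sh) (set (drop_item r p) \<union> R)) + (a + b * of_nat (defects (drop_item r p))))
    \<le> cE * of_bool (bad Sh (set p \<union> R)) + call_cost cT cE a b p"
proof -
  define X where "X z = (case mnbs p z of None \<Rightarrow> \<infinity> | Some (_, t) \<Rightarrow> ennreal (real t))" for z
  define E where "E = {z. \<not> (\<exists>t. mnbs p z = Some (find (\<lambda>x. x \<in> S) p, t))}"
  \<comment> \<open>The penalty of a wrong answer: \<open>cE\<close> for possible damage, and
    \<open>b\<close> if a defective should have been removed.\<close>
  define e where "e = (if defects p = 0 then cE else cE + b)"
  define c where "c = (if defects p = 0 then a else a + b * of_nat (defects p - 1))"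
  have X [measurable]: "X \<in> borel_measurable (noise \<rho>)"
    unfolding X_def
    using measurable_compose[OF measurable_stopping[OF stopping_strat_run[of S "B d p"], of \<rho>],
       of "\<lambda>x. case x of None \<Rightarrow> \<infinity> | Some (_, t) \<Rightarrow> ennreal (real t)" borel] by simp
  have "E = mnbs p -` (- {Some (find (\<lambda>x. x \<in> S) p, t) | t. True}) \<inter> space (noise \<rho>)"
    by (auto simp: E_def)
  also have "\<dots> \<in> sets (noise \<rho>)"
    by (rule measurable_sets[OF measurable_stopping[OF stopping_strat_run]]) simp
  finally have E [measurable]: "E \<in> sets (noise \<rho>)" .
  have XW: "(\<integral>\<^sup>+ z. X z \<partial>noise \<rho>) \<le> ennreal W"
    unfolding X_def using mnbs_cost[of p] p by (simp add: proper_def)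
  then have "(\<integral>\<^sup>+ z. X z \<partial>noise \<rho>) \<noteq> \<infinity>" by (auto simp: top_unique)
  \<comment> \<open>This matters for \<open>cT = 0\<close>, where \<open>cT * X z\<close> is 0 and
    does not dominate the value \<open>\<top>\<close> of a run that never stops.\<close>
  then have fin: "AE z in noise \<rho>. X z \<noteq> \<infinity>" by (rule nn_integral_PInf_AE[OF X])
  have pw: "cT * of_nat t + cE * of_bool (bad (add_item r Sh) (set (drop_item r p) \<union> R))
      + (a + b * of_nat (defects (drop_item r p)))
      \<le> cT * X z + (cE * of_bool (bad Sh (set p \<union> R)) + c) + e * indicator E z"
    if run: "mnbs p z = Some (r, t)" for z r t
  proof (cases "r = find (\<lambda>x. x \<in> S) p")
    case True
    have "cE * of_bool (bad (add_item r Sh) (set (drop_item r p) \<union> R)) \<le> cE * of_bool (bad Sh (set p \<union> R))"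
      using drop_find(2)[OF True] by (intro mult_left_mono) auto
    moreover have "a + b * of_nat (defects (drop_item r p)) = c"
      using drop_find(1)[OF True] by (simp add: c_def)
    moreover have "X z = of_nat t" using run by (simp add: X_def ennreal_of_nat_eq_real_of_nat)
    moreover have "indicator E z = (0::ennreal)" using run True by (simp add: E_def)
    ultimately show ?thesis by (simp add: add.assoc add_left_mono add_right_mono)
  next
    case False
    have "cE * of_bool (bad (add_item r Sh) (set (drop_item r p) \<union> R)) \<le> cE"
      by simp
    moreover have "a + b * of_nat (defects (drop_item r p)) \<le> c + (if defects p = 0 then 0 else b)"
    proof (cases "defects p")
      case 0
      then show ?thesis using defects_drop_item_le[of r p] by (simp add: c_def)
    next
      case (Suc s)
      have "b * of_nat (defects (drop_item r p)) \<le> b * of_nat (Suc s)"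
        using defects_drop_item_le[of r p] Suc by (intro mult_left_mono) (auto simp del: of_nat_Suc)
      also have "\<dots> = b * of_nat s + b" by (simp add: algebra_simps)
      finally show ?thesis using Suc by (simp add: c_def add.assoc add_left_mono)
    qed
    ultimately have "cE * of_bool (bad (add_item r Sh) (set (drop_item r p) \<union> R))
        + (a + b * of_nat (defects (drop_item r p))) \<le> cE + (c + (if defects p = 0 then 0 else b))"
      by (rule add_mono)
    also have "\<dots> = c + e" by (simp add: e_def add_ac)
    also have "\<dots> \<le> cE * of_bool (bad Sh (set p \<union> R)) + c + e"
      by (simp add: add_increasing add_right_mono)
    finally have "cT * of_nat t + (cE * of_bool (bad (add_item r Sh) (set (drop_item r p) \<union> R))
        + (a + b * of_nat (defects (drop_item r p))))
      \<le> cT * of_nat t + (cE * of_bool (bad Sh (set p \<union> R)) + c + e)" by (rule add_left_mono)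
    moreover have "X z = of_nat t" using run by (simp add: X_def ennreal_of_nat_eq_real_of_nat)
    moreover have "indicator E z = (1::ennreal)" using run False by (simp add: E_def)
    ultimately show ?thesis by (simp add: add.assoc)
  qed
  have "expect_proc \<rho> (mnbs p) (\<lambda>r t. cT * of_nat t
      + cE * of_bool (bad (add_item r Sh) (set (drop_item r p) \<union> R)) + (a + b * of_nat (defects (drop_item r p))))
    \<le> (\<integral>\<^sup>+ z. cT * X z + (cE * of_bool (bad Sh (set p \<union> R)) + c) + e * indicator E z \<partial>noise \<rho>)"
    unfolding expect_proc_def
  proof (rule nn_integral_mono_AE)
    show "AE z in noise \<rho>. (case mnbs p z of None \<Rightarrow> \<top> | Some (r, t) \<Rightarrow> cT * of_nat t
      + cE * of_bool (bad (add_item r Sh) (set (drop_item r p) \<union> R)) + (a + b * of_nat (defects (drop_item r p))))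
      \<le> cT * X z + (cE * of_bool (bad Sh (set p \<union> R)) + c) + e * indicator E z"
      using fin
    proof (eventually_elim)
      case (elim z)
      then obtain r t where run: "mnbs p z = Some (r, t)" by (auto simp: X_def split: option.splits)
      then show ?case using pw[OF run] by simp
    qed
  qed
  also have "\<dots> = cT * (\<integral>\<^sup>+ z. X z \<partial>noise \<rho>) + (cE * of_bool (bad Sh (set p \<union> R)) + c)
      + e * emeasure (noise \<rho>) E"
  proof -
    let ?k = "cE * of_bool (bad Sh (set p \<union> R)) + c"
    have m: "(\<lambda>z. cT * X z + e * indicator E z) \<in> borel_measurable (noise \<rho>)"
      by (rule borel_measurable_noise_linear[OF X borel_measurable_indicator[OF E]])
    have "(\<integral>\<^sup>+ z. cT * X z + ?k + e * indicator E z \<partial>noise \<rho>)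
        = (\<integral>\<^sup>+ z. ?k + (cT * X z + e * indicator E z) \<partial>noise \<rho>)"
      by (intro nn_integral_cong) (simp only: add_ac)
    also have "\<dots> = ?k + (cT * (\<integral>\<^sup>+ z. X z \<partial>noise \<rho>) + e * emeasure (noise \<rho>) E)"
      unfolding nn_integral_noise_const_add[OF m]
      unfolding nn_integral_noise_linear[OF X borel_measurable_indicator[OF E]] nn_integral_indicator[OF E] ..
    finally show ?thesis by (simp only: add_ac)
  qed
  also have "\<dots> \<le> cT * ennreal W + (cE * of_bool (bad Sh (set p \<union> R)) + c) + e * ennreal d"
    using XW emeasure_mnbs_error[OF p] by (intro add_mono mult_left_mono) (auto simp: E_def)
  also have "\<dots> = cE * of_bool (bad Sh (set p \<union> R)) + call_cost cT cE a b p"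
    by (simp add: call_cost_def e_def c_def distrib_right add_ac)
  finally show ?thesis .
qed

lemma val_add_time: "val cT cE a b R x (t + u) = cT * of_nat t + val cT cE a b R x u"
  by (simp add: val_def distrib_left add_ac)

text \<open>A processed partition leaves the list, pays its own potential and hands its items over
  to \<open>R\<close>.\<close>

lemma val_Cons:
  "val cT cE a b R (q # qs, Sh) t = (a + b * of_nat (defects q)) + val cT cE a b (set q \<union> R) (qs, Sh) t"
proof -
  have "items (q # qs) \<union> R = items qs \<union> (set q \<union> R)" by (auto simp: items_def)
  then show ?thesis by (simp add: val_def potential_def add_ac)
qed

text \<open>While the head is searched, the untouched tail counts as part of \<open>R\<close>; while
  the tail is searched, what is left of the head does. The induction therefore ranges over all
  \<open>R\<close>.\<close>

lemma expect_mnbs_proc_le: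
  assumes "\<forall>p\<in>set ps. proper p"
  shows "expect_proc \<rho> (mnbs_proc ps Sh) (val cT cE a b R)
    \<le> cE * of_bool (bad Sh (items ps \<union> R)) + (\<Sum>p\<leftarrow>ps. call_cost cT cE a b p)"
  using assms
proof (induction ps arbitrary: Sh R)
  case Nil
  show ?case by (simp add: val_def potential_def)
next
  case (Cons p ps)
  let ?u = "call_cost cT cE a b"
  have "expect_proc \<rho> (mnbs_proc (p # ps) Sh) (val cT cE a b R)
    = expect_proc \<rho> (mnbs p) (\<lambda>r t. expect_proc \<rho> (mnbs_proc ps (add_item r Sh))
        (\<lambda>x u. val cT cE a b R (drop_item r p # fst x, snd x) (t + u)))"
    by (simp add: expect_bind_proc stopping_strat_run stopping_mnbs_proc stopping_return_proc stopping_bind_proc)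
  also have "\<dots> \<le> expect_proc \<rho> (mnbs p) (\<lambda>r t. (\<Sum>p\<leftarrow>ps. ?u p) + (cT * of_nat t
      + cE * of_bool (bad (add_item r Sh) (set (drop_item r p) \<union> (items ps \<union> R)))
      + (a + b * of_nat (defects (drop_item r p)))))"
  proof (rule expect_proc_mono)
    fix r t
    let ?q = "drop_item r p"
    have "expect_proc \<rho> (mnbs_proc ps (add_item r Sh)) (\<lambda>x u. val cT cE a b R (?q # fst x, snd x) (t + u))
      = expect_proc \<rho> (mnbs_proc ps (add_item r Sh))
          (\<lambda>x u. (cT * of_nat t + (a + b * of_nat (defects ?q))) + val cT cE a b (set ?q \<union> R) x u)"
      by (simp add: val_add_time val_Cons add.assoc)
    also have "\<dots> = (cT * of_nat t + (a + b * of_nat (defects ?q)))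
        + expect_proc \<rho> (mnbs_proc ps (add_item r Sh)) (val cT cE a b (set ?q \<union> R))"
      by (rule expect_proc_add_const[OF stopping_mnbs_proc])
    also have "\<dots> \<le> (cT * of_nat t + (a + b * of_nat (defects ?q)))
        + (cE * of_bool (bad (add_item r Sh) (items ps \<union> (set ?q \<union> R))) + (\<Sum>p\<leftarrow>ps. ?u p))"
      using Cons by (intro add_left_mono) simp
    also have "items ps \<union> (set ?q \<union> R) = set ?q \<union> (items ps \<union> R)" by auto
    finally show "expect_proc \<rho> (mnbs_proc ps (add_item r Sh)) (\<lambda>x u. val cT cE a b R (?q # fst x, snd x) (t + u))
      \<le> (\<Sum>p\<leftarrow>ps. ?u p) + (cT * of_nat t
      + cE * of_bool (bad (add_item r Sh) (set ?q \<union> (items ps \<union> R))) + (a + b * of_nat (defects ?q)))"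
      by (simp add: add_ac)
  qed
  also have "\<dots> \<le> (\<Sum>p\<leftarrow>ps. ?u p) + (cE * of_bool (bad Sh (set p \<union> (items ps \<union> R))) + ?u p)"
    unfolding expect_proc_add_const[OF stopping_strat_run]
    using Cons.prems by (intro add_left_mono expect_mnbs_le) simp
  also have "set p \<union> (items ps \<union> R) = items (p # ps) \<union> R" by (auto simp: items_def)
  finally show ?case by (simp add: add_ac)
qed

lemma expect_round_proc_le:
  assumes Ps: "\<forall>p\<in>set Ps. proper p"
    and c0: "cT * of_nat reps + (cT * ennreal W + cE * ennreal d + a) * ennreal d \<le> a"
    and c1: "cT * of_nat reps + cE * ennreal d + (cT * ennreal W + cE * ennreal d + b * ennreal d) \<le> b"
  shows "expect_proc \<rho> (round_proc Ps Sh) (val cT cE a b {}) \<le> val cT cE a b {} (Ps, Sh) 0"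
proof -
  let ?u = "call_cost cT cE a b" and ?n = "length Ps"
  define flag where "flag i z = rep_test S z reps (i * reps) (set (Ps ! i))" for i z
  \<comment> \<open>An unflagged partition is discarded with its potential, so all it can cost is
    the damage done if it held a defective.\<close>
  define pay where "pay i z = (if flag i z then ?u (Ps ! i) else cE * of_bool (defects (Ps ! i) \<noteq> 0))" for i z
  have flag_m: "(\<lambda>z. flag i z) \<in> measurable (noise \<rho>) (count_space UNIV)" for i
    unfolding flag_def by (rule measurable_prefix_determined[OF prefix_determined_rep_test])
  have flag_s: "{z. flag i z} \<in> sets (noise \<rho>)" "{z. \<not> flag i z} \<in> sets (noise \<rho>)" for i
    using flag_m[of i] measurable_compose[OF flag_m[of i], of Not "count_space UNIV"] by (simp_all add: pred_def)
  have pay_eq: "pay i z = ?u (Ps ! i) * indicator {z. flag i z} z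
      + cE * of_bool (defects (Ps ! i) \<noteq> 0) * indicator {z. \<not> flag i z} z" for i z
    by (simp add: pay_def)
  have pay_m: "pay i \<in> borel_measurable (noise \<rho>)" for i
    unfolding pay_eq[abs_def]
    by (rule borel_measurable_noise_linear[OF borel_measurable_indicator[OF flag_s(1)] borel_measurable_indicator[OF flag_s(2)]])
  have fl: "flagged Ps z = map ((!) Ps) (filter (\<lambda>i. flag i z) [0..<?n])" for z
    by (simp add: flagged_def flag_def)
  have fl_sum: "(\<Sum>p\<leftarrow>flagged Ps z. ?u p) = (\<Sum>i<?n. if flag i z then ?u (Ps ! i) else 0)" for z
    by (simp add: fl sum_list_map_filter' comp_def interv_sum_list_conv_sum_set_nat atLeast0LessThan)
  have fl_items: "items (flagged Ps z) = (\<Union>i\<in>{i. i < ?n \<and> flag i z}. set (Ps ! i))" for z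
    by (auto simp: fl items_def)
  \<comment> \<open>New damage from discarding needs a defective inside some unflagged partition,
    and that partition contributes \<open>cE\<close> to the sum.\<close>
  have bad_le: "cE * of_bool (bad Sh (items (flagged Ps z)))
      \<le> cE * of_bool (bad Sh (items Ps)) + (\<Sum>i<?n. if flag i z then 0 else cE * of_bool (defects (Ps ! i) \<noteq> 0))" for z
  proof (cases "bad Sh (items (flagged Ps z)) \<and> \<not> bad Sh (items Ps)")
    case True
    then obtain x where x: "x \<in> S" "x \<in> items Ps" "x \<notin> items (flagged Ps z)"
      by (auto simp: bad_def)
    from x(2) obtain p where "p \<in> set Ps" "x \<in> set p" by (auto simp: items_def)
    then obtain i where i: "i < ?n" "x \<in> set (Ps ! i)" by (metis in_set_conv_nth)
    have "\<not> flag i z" using x i unfolding fl_items by blast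
    moreover have "defects (Ps ! i) \<noteq> 0" using x i unfolding defects_eq_0_iff by blast
    ultimately have "cE \<le> (if flag i z then 0 else cE * of_bool (defects (Ps ! i) \<noteq> 0))" by simp
    also have "\<dots> \<le> (\<Sum>i<?n. if flag i z then 0 else cE * of_bool (defects (Ps ! i) \<noteq> 0))"
      using i by (intro member_le_sum) auto
    finally show ?thesis using True by simp
  next
    case False
    then show ?thesis by (auto intro: add_increasing2)
  qed
  have "expect_proc \<rho> (round_proc Ps Sh) (val cT cE a b {})
    = expect_proc \<rho> (\<lambda>z. Some (flagged Ps z, ?n * reps)) (\<lambda>fs t. expect_proc \<rho> (mnbs_proc fs Sh)
        (\<lambda>x u. val cT cE a b {} (filter (\<lambda>q. q \<noteq> []) (fst x), snd x) (t + u)))"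
    by (simp add: round_proc_def expect_bind_proc stopping_flagged stopping_mnbs_proc
        stopping_return_proc stopping_bind_proc)
  also have "\<dots> \<le> expect_proc \<rho> (\<lambda>z. Some (flagged Ps z, ?n * reps)) (\<lambda>fs t.
      cT * of_nat t + (cE * of_bool (bad Sh (items fs)) + (\<Sum>p\<leftarrow>fs. ?u p)))"
  proof (rule expect_proc_mono)
    fix z fs t assume "Some (flagged Ps z, ?n * reps) = Some (fs, t)"
    then have "\<forall>p\<in>set fs. proper p" using Ps set_flagged[of Ps z] by auto
    from expect_mnbs_proc_le[OF this, of Sh cT cE a b "{}"]
    have IH: "expect_proc \<rho> (mnbs_proc fs Sh) (val cT cE a b {}) \<le> cE * of_bool (bad Sh (items fs)) + (\<Sum>p\<leftarrow>fs. ?u p)"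
      by simp
    \<comment> \<open>Discarding partitions without items keeps the set of items in play and can
      only lower the potential.\<close>
    have "val cT cE a b {} (filter (\<lambda>q. q \<noteq> []) (fst x), snd x) (t + u) \<le> cT * of_nat t + val cT cE a b {} x u" for x u
    proof -
      have "items (filter (\<lambda>q. q \<noteq> []) (fst x)) = items (fst x)" by (auto simp: items_def)
      moreover have "potential a b (filter (\<lambda>q. q \<noteq> []) qs) \<le> potential a b qs" for qs
        by (induction qs) (auto simp: potential_def add_increasing add_left_mono)
      ultimately show ?thesis unfolding val_add_time by (simp add: val_def add_left_mono)
    qed
    then have "expect_proc \<rho> (mnbs_proc fs Sh) (\<lambda>x u. val cT cE a b {} (filter (\<lambda>q. q \<noteq> []) (fst x), snd x) (t + u))
      \<le> expect_proc \<rho> (mnbs_proc fs Sh) (\<lambda>x u. cT * of_nat t + val cT cE a b {} x u)"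
      by (intro expect_proc_mono)
    also have "\<dots> = cT * of_nat t + expect_proc \<rho> (mnbs_proc fs Sh) (val cT cE a b {})"
      by (rule expect_proc_add_const[OF stopping_mnbs_proc])
    also have "\<dots> \<le> cT * of_nat t + (cE * of_bool (bad Sh (items fs)) + (\<Sum>p\<leftarrow>fs. ?u p))"
      by (rule add_left_mono[OF IH])
    finally show "expect_proc \<rho> (mnbs_proc fs Sh) (\<lambda>x u. val cT cE a b {} (filter (\<lambda>q. q \<noteq> []) (fst x), snd x) (t + u))
      \<le> cT * of_nat t + (cE * of_bool (bad Sh (items fs)) + (\<Sum>p\<leftarrow>fs. ?u p))" .
  qed
  also have "\<dots> = (\<integral>\<^sup>+ z. cT * of_nat (?n * reps)
      + (cE * of_bool (bad Sh (items (flagged Ps z))) + (\<Sum>p\<leftarrow>flagged Ps z. ?u p)) \<partial>noise \<rho>)"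
    by (simp add: expect_proc_def)
  also have "\<dots> \<le> (\<integral>\<^sup>+ z. cT * of_nat (?n * reps) + cE * of_bool (bad Sh (items Ps)) + (\<Sum>i<?n. pay i z) \<partial>noise \<rho>)"
  proof (rule nn_integral_mono)
    fix z
    have "(\<Sum>i<?n. pay i z) = (\<Sum>i<?n. if flag i z then 0 else cE * of_bool (defects (Ps ! i) \<noteq> 0))
        + (\<Sum>i<?n. if flag i z then ?u (Ps ! i) else 0)"
      unfolding sum.distrib[symmetric] by (intro sum.cong) (auto simp: pay_def)
    note pay_split = this
    show "cT * of_nat (?n * reps) + (cE * of_bool (bad Sh (items (flagged Ps z))) + (\<Sum>p\<leftarrow>flagged Ps z. ?u p))
      \<le> cT * of_nat (?n * reps) + cE * of_bool (bad Sh (items Ps)) + (\<Sum>i<?n. pay i z)"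
      unfolding fl_sum pay_split add.assoc
      by (intro add_left_mono) (use add_right_mono[OF bad_le[of z]] in \<open>simp only: add.assoc\<close>)
  qed
  also have "\<dots> = cT * of_nat (?n * reps) + cE * of_bool (bad Sh (items Ps)) + (\<Sum>i<?n. \<integral>\<^sup>+ z. pay i z \<partial>noise \<rho>)"
    by (simp only: nn_integral_noise_const_add[OF borel_measurable_sum[OF pay_m]] nn_integral_sum[OF pay_m])
  also have "\<dots> = cE * of_bool (bad Sh (items Ps)) + (\<Sum>i<?n. cT * of_nat reps + (\<integral>\<^sup>+ z. pay i z \<partial>noise \<rho>))"
    by (simp add: sum.distrib mult_ac add_ac)
  also have "\<dots> \<le> cE * of_bool (bad Sh (items Ps)) + (\<Sum>i<?n. a + b * of_nat (defects (Ps ! i)))"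
  proof (intro add_left_mono sum_mono)
    fix i assume "i \<in> {..<?n}"
    have int: "(\<integral>\<^sup>+ z. pay i z \<partial>noise \<rho>) = ?u (Ps ! i) * emeasure (noise \<rho>) {z. flag i z}
      + cE * of_bool (defects (Ps ! i) \<noteq> 0) * emeasure (noise \<rho>) {z. \<not> flag i z}"
      unfolding pay_eq
      by (simp only: nn_integral_noise_linear[OF borel_measurable_indicator[OF flag_s(1)] borel_measurable_indicator[OF flag_s(2)]]
          nn_integral_indicator[OF flag_s(1)] nn_integral_indicator[OF flag_s(2)])
    show "cT * of_nat reps + (\<integral>\<^sup>+ z. pay i z \<partial>noise \<rho>) \<le> a + b * of_nat (defects (Ps ! i))"
    proof (cases "defects (Ps ! i)")
      case 0
      then have "set (Ps ! i) \<inter> S = {}" by (simp only: defects_eq_0_iff)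
      then have "emeasure (noise \<rho>) {z. flag i z} \<le> ennreal d"
        unfolding flag_def by (rule rep_test_false_alarm[OF rho d(1)])
      then have "?u (Ps ! i) * emeasure (noise \<rho>) {z. flag i z} \<le> (cT * ennreal W + cE * ennreal d + a) * ennreal d"
        using 0 by (intro mult_mono) (auto simp: call_cost_def)
      then have "cT * of_nat reps + (\<integral>\<^sup>+ z. pay i z \<partial>noise \<rho>)
          \<le> cT * of_nat reps + (cT * ennreal W + cE * ennreal d + a) * ennreal d"
        unfolding int using 0 by (simp add: add_left_mono)
      also have "\<dots> \<le> a" by (rule c0)
      finally show ?thesis using 0 by simp
    next
      case (Suc s)
      then have "set (Ps ! i) \<inter> S \<noteq> {}" unfolding defects_eq_0_iff[symmetric] by simp
      then have miss: "emeasure (noise \<rho>) {z. \<not> flag i z} \<le> ennreal d"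
        unfolding flag_def by (rule rep_test_miss[OF rho d(1)])
      \<comment> \<open>The trivial bound 1 is enough here: the full price of an MNBS call and the
        price of a miss are both charged, although only one of them occurs.\<close>
      have "emeasure (noise \<rho>) {z. flag i z} \<le> 1"
        using emeasure_mono[of "{z. flag i z}" UNIV "noise \<rho>"] sets.top[of "noise \<rho>"] by simp
      then have "?u (Ps ! i) * emeasure (noise \<rho>) {z. flag i z} \<le> ?u (Ps ! i) * 1"
        by (rule mult_left_mono) simp
      moreover have "cE * of_bool (defects (Ps ! i) \<noteq> 0) * emeasure (noise \<rho>) {z. \<not> flag i z} \<le> cE * ennreal d"
        using miss Suc by (simp add: mult_left_mono)
      ultimately have "(\<integral>\<^sup>+ z. pay i z \<partial>noise \<rho>) \<le> ?u (Ps ! i) * 1 + cE * ennreal d"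
        unfolding int by (rule add_mono)
      then have "cT * of_nat reps + (\<integral>\<^sup>+ z. pay i z \<partial>noise \<rho>) \<le> cT * of_nat reps + (?u (Ps ! i) * 1 + cE * ennreal d)"
        by (rule add_left_mono)
      also have "\<dots> = (cT * of_nat reps + cE * ennreal d + (cT * ennreal W + cE * ennreal d + b * ennreal d))
          + (a + b * of_nat s)"
        using Suc by (simp add: call_cost_def add_ac)
      also have "\<dots> \<le> b + (a + b * of_nat s)" by (rule add_right_mono[OF c1])
      also have "\<dots> = a + b * of_nat (defects (Ps ! i))" using Suc by (simp add: distrib_left add_ac)
      finally show ?thesis .
    qed
  qed
  also have "\<dots> = val cT cE a b {} (Ps, Sh) 0"
  proof -
    have "potential a b Ps = (\<Sum>i<?n. a + b * of_nat (defects (Ps ! i)))"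
      unfolding potential_def by (simp add: sum_list_sum_nth atLeast0LessThan)
    then show ?thesis by (simp add: val_def)
  qed
  finally show ?thesis .
qed

lemma expect_state_proc_le:
  assumes P: "\<forall>p\<in>set P. proper p"
    and c0: "cT * of_nat reps + (cT * ennreal W + cE * ennreal d + a) * ennreal d \<le> a"
    and c1: "cT * of_nat reps + cE * ennreal d + (cT * ennreal W + cE * ennreal d + b * ennreal d) \<le> b"
  shows "expect_proc \<rho> (state_proc P r) (val cT cE a b {}) \<le> val cT cE a b {} (P, {}) 0"
proof (induction r)
  case 0
  show ?case by simp
next
  case (Suc r)
  let ?g = "\<lambda>x. if fst x = [] then return_proc x else round_proc (fst x) (snd x)"
  have g: "stopping (?g x)" for x
    by (simp add: stopping_return_proc stopping_round_proc)
  have "expect_proc \<rho> (state_proc P (Suc r)) (val cT cE a b {})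
     = expect_proc \<rho> (state_proc P r) (\<lambda>x t. expect_proc \<rho> (?g x) (\<lambda>y u. val cT cE a b {} y (t + u)))"
    unfolding state_proc.simps by (rule expect_bind_proc[OF stopping_state_proc g])
  also have "\<dots> \<le> expect_proc \<rho> (state_proc P r) (val cT cE a b {})"
  proof (rule expect_proc_mono)
    fix z x t assume "state_proc P r z = Some (x, t)"
    then have x: "\<forall>p\<in>set (fst x). proper p" using P by (rule state_proc_proper)
    have "expect_proc \<rho> (?g x) (\<lambda>y u. val cT cE a b {} y (t + u))
        = cT * of_nat t + expect_proc \<rho> (?g x) (val cT cE a b {})"
      unfolding val_add_time by (rule expect_proc_add_const[OF g])
    also have "\<dots> \<le> cT * of_nat t + val cT cE a b {} x 0"
      using expect_round_proc_le[OF x c0 c1, of "snd x"] by (intro add_left_mono) auto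
    also have "\<dots> = val cT cE a b {} x t" unfolding val_add_time[symmetric] by simp
    finally show "expect_proc \<rho> (?g x) (\<lambda>y u. val cT cE a b {} y (t + u)) \<le> val cT cE a b {} x t" .
  qed
  also note Suc
  finally show ?case .
qed

subsection \<open>Termination, cost and success\<close>

lemma state_proc_absorbing:
  assumes "state_proc P r z = Some (([], Sh), t)" "r \<le> r'"
  shows "state_proc P r' z = Some (([], Sh), t)"
  using assms(2,1) by (induction rule: dec_induct) (simp_all add: bind_proc_def return_proc_def)

text \<open>Final states are absorbing, so the first terminating round can be replaced by any
  terminating round and the \<open>LEAST\<close> in \<open>alg1_run\<close> disappears.\<close>

lemma alg1_run_eq_Some_iff:
  assumes "d = \<delta> / real k"
  shows "alg1_run \<rho> B k \<delta> P S z = Some (Sh, t) \<longleftrightarrow> (\<exists>r. state_proc P r z = Some (([], Sh), t))"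
proof -
  define F where "F r = alg_states \<rho> S z B d P r" for r
  have F: "F r = Some (Ps, Sh, t) \<longleftrightarrow> state_proc P r z = Some ((Ps, Sh), t)" for r Ps Sh t
    by (auto simp: F_def alg_states_eq)
  define Q where "Q r \<longleftrightarrow> (\<exists>st. F r = Some st \<and> fst st = [])" for r
  have run: "alg1_run \<rho> B k \<delta> P S z = (if \<exists>r. Q r
      then (case F (LEAST r. Q r) of None \<Rightarrow> None | Some (_, Sh, t) \<Rightarrow> Some (Sh, t)) else None)"
    unfolding alg1_run_def assms[symmetric] Let_def F_def[symmetric] Q_def by simp
  show ?thesis
  proof (cases "\<exists>r. Q r")
    case True
    define r0 where "r0 = (LEAST r. Q r)"
    have "Q r0" unfolding r0_def using True by (rule LeastI_ex)
    then obtain Sh0 t0 where F0: "F r0 = Some ([], Sh0, t0)" unfolding Q_def by (auto simp: fst_def split: prod.splits)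
    have "state_proc P r z = Some (([], Sh), t) \<Longrightarrow> Sh = Sh0 \<and> t = t0" for r
      using state_proc_absorbing[of P r z Sh t "max r r0"] state_proc_absorbing[of P r0 z Sh0 t0 "max r r0"] F0
      unfolding F by auto
    then show ?thesis using F0 True unfolding run r0_def[symmetric] F by (auto simp: F0)
  next
    case False
    then have "state_proc P r z \<noteq> Some (([], Sh), t)" for r unfolding Q_def F[symmetric] by fastforce
    then show ?thesis using False by (simp add: run)
  qed
qed

lemma stopping_alg1_run:
  assumes "d = \<delta> / real k"
  shows "stopping (alg1_run \<rho> B k \<delta> P S)"
  unfolding stopping_def alg1_run_eq_Some_iff[OF assms]
  using stoppingD[OF stopping_state_proc] by blast

text \<open>Every round with partitions left makes at least one test. Endless rounds thus mean
  endless tests, which lets a bound on the tests also yield termination.\<close>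

lemma state_proc_time:
  assumes "1 \<le> reps"
  shows "state_proc P r z = Some (x, t) \<Longrightarrow> fst x \<noteq> [] \<Longrightarrow> r \<le> t"
proof (induction r arbitrary: x t)
  case 0
  show ?case by simp
next
  case (Suc r)
  from Suc.prems(1) obtain y c u where y: "state_proc P r z = Some (y, c)" and t: "t = c + u"
    and x: "(if fst y = [] then return_proc y else round_proc (fst y) (snd y)) (\<lambda>j. z (c + j)) = Some (x, u)"
    by (auto simp: bind_proc_def split: option.splits prod.splits)
  have ne: "fst y \<noteq> []" using x Suc.prems(2) by (auto simp: return_proc_def)
  then have "length (fst y) * reps \<le> u"
    using x by (auto simp: round_proc_def bind_proc_def split: option.splits prod.splits)
  moreover have "1 \<le> length (fst y) * reps" using ne assms by (cases "fst y") auto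
  ultimately show ?case using Suc.IH[OF y ne] t by linarith
qed

text \<open>The potential with weights \<open>(cT, cE) = (1, 0)\<close> bounds the cost after every
  number of rounds, and monotone convergence carries the bound to the whole run.\<close>

lemma expected_tests_le:
  assumes dk: "d = \<delta> / real k" and reps: "1 \<le> reps" and P: "\<forall>p\<in>set P. proper p"
    and c0: "of_nat reps + (ennreal W + a) * ennreal d \<le> a"
    and c1: "of_nat reps + (ennreal W + b * ennreal d) \<le> b"
  shows "alg1_expected_tests \<rho> B k \<delta> P S \<le> potential a b P"
proof -
  define cost where "cost r z = (case state_proc P r z of None \<Rightarrow> \<top> | Some (_, t) \<Rightarrow> (of_nat t :: ennreal))" for r z
  have cost_m: "cost r \<in> borel_measurable (noise \<rho>)" for r
    unfolding cost_def
    using measurable_compose[OF measurable_stopping[OF stopping_state_proc[of P r], of \<rho>],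
       of "\<lambda>x. case x of None \<Rightarrow> \<top> | Some (_, t) \<Rightarrow> (of_nat t :: ennreal)" borel] by simp
  have "cost r z \<le> cost (Suc r) z" for r z
    by (auto simp: cost_def bind_proc_def split: option.splits)
  then have inc: "incseq cost" by (intro incseq_SucI le_funI)
  have pw: "(case alg1_run \<rho> B k \<delta> P S z of None \<Rightarrow> \<infinity> | Some (_, T) \<Rightarrow> ennreal (real T)) \<le> (SUP r. cost r z)" for z
  proof (cases "alg1_run \<rho> B k \<delta> P S z")
    case None
    \<comment> \<open>A run without result is either stuck inside a round, where \<open>cost\<close>
      is \<open>\<top>\<close>, or passes through all rounds and spends at least one test in
      each.\<close>
    have "of_nat r \<le> cost r z" for r
    proof (cases "state_proc P r z")
      case None
      then show ?thesis by (simp add: cost_def)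
    next
      case (Some y)
      obtain Ps Sh t where y: "y = ((Ps, Sh), t)" by (metis prod.exhaust)
      have "Ps \<noteq> []"
        using alg1_run_eq_Some_iff[OF dk, of P z Sh t] \<open>alg1_run \<rho> B k \<delta> P S z = None\<close> Some y by auto
      then have "r \<le> t" using state_proc_time[OF reps] Some y by fastforce
      then show ?thesis using Some y by (simp add: cost_def)
    qed
    then have "(SUP r. of_nat r) \<le> (SUP r. cost r z)" by (intro SUP_mono) blast
    then show ?thesis using None by (simp add: ennreal_SUP_of_nat_eq_top)
  next
    case (Some y)
    obtain Sh T where y: "y = (Sh, T)" by fastforce
    then obtain r where "state_proc P r z = Some (([], Sh), T)"
      using Some alg1_run_eq_Some_iff[OF dk] by auto
    then have "ennreal (real T) = cost r z" by (simp add: cost_def ennreal_of_nat_eq_real_of_nat)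
    also have "\<dots> \<le> (SUP r. cost r z)" by (rule SUP_upper) simp
    finally show ?thesis using Some y by simp
  qed
  have "alg1_expected_tests \<rho> B k \<delta> P S \<le> (\<integral>\<^sup>+ z. (SUP r. cost r z) \<partial>noise \<rho>)"
    unfolding alg1_expected_tests_def by (rule nn_integral_mono) (rule pw)
  also have "\<dots> = (SUP r. \<integral>\<^sup>+ z. cost r z \<partial>noise \<rho>)"
    by (rule nn_integral_monotone_convergence_SUP[OF inc cost_m])
  also have "\<dots> \<le> potential a b P"
  proof (rule SUP_least)
    fix r
    have "(\<integral>\<^sup>+ z. cost r z \<partial>noise \<rho>) \<le> expect_proc \<rho> (state_proc P r) (val 1 0 a b {})"
      unfolding expect_proc_def
      by (rule nn_integral_mono) (auto simp: cost_def val_def split: option.splits)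
    also have "\<dots> \<le> val 1 0 a b {} (P, {}) 0"
      using c0 c1 by (intro expect_state_proc_le[OF P]) simp_all
    also have "\<dots> = potential a b P" by (simp add: val_def)
    finally show "(\<integral>\<^sup>+ z. cost r z \<partial>noise \<rho>) \<le> potential a b P" .
  qed
  finally show ?thesis .
qed

text \<open>Finite expected cost makes termination almost sure. Up to a null set, failure is then
  the increasing union over \<open>r\<close> of having stopped by round \<open>r\<close> with a
  wrong set, and the potential with weights \<open>(cT, cE) = (0, 1)\<close> bounds each of these
  events.\<close>

lemma success_prob_ge:
  assumes dk: "d = \<delta> / real k" and P: "\<forall>p\<in>set P. proper p" and S: "S \<subseteq> items P"
    and fin: "alg1_expected_tests \<rho> B k \<delta> P S \<noteq> \<top>"
    and c0: "(ennreal d + a) * ennreal d \<le> a"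
    and c1: "ennreal d + (ennreal d + b * ennreal d) \<le> b"
    and x: "potential a b P \<le> ennreal x" "0 \<le> x"
  shows "1 - x \<le> alg1_success_prob \<rho> B k \<delta> P S"
proof -
  interpret N: prob_space "noise \<rho>" by (rule prob_space_noise)
  let ?run = "alg1_run \<rho> B k \<delta> P S"
  have run_sets: "?run -` A \<in> sets (noise \<rho>)" for A
    using measurable_sets[OF measurable_stopping[OF stopping_alg1_run[OF dk]], of A] by simp
  define wrong where "wrong r = state_proc P r -` {Some (([], Sh), t) | Sh t. Sh \<noteq> S}" for r
  have wrong_sets: "wrong r \<in> sets (noise \<rho>)" for r
    using measurable_sets[OF measurable_stopping[OF stopping_state_proc[of P r]],
        of "{Some (([], Sh), t) | Sh t. Sh \<noteq> S}"]
    unfolding wrong_def by (simp del: vimage_Collect_eq)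
  have "wrong r \<subseteq> wrong (Suc r)" for r
  proof
    fix z assume "z \<in> wrong r"
    then obtain Sh t where Sh: "state_proc P r z = Some (([], Sh), t)" "Sh \<noteq> S"
      by (auto simp: wrong_def)
    from state_proc_absorbing[OF Sh(1) le_SucI[OF order_refl]] Sh(2)
    show "z \<in> wrong (Suc r)" by (simp add: wrong_def)
  qed
  then have inc: "incseq wrong" by (intro incseq_SucI)
  have wrong_le: "emeasure (noise \<rho>) (wrong r) \<le> ennreal x" for r
  proof -
    have "emeasure (noise \<rho>) (wrong r) = (\<integral>\<^sup>+ z. indicator (wrong r) z \<partial>noise \<rho>)"
      by (rule nn_integral_indicator[symmetric, OF wrong_sets])
    also have "\<dots> \<le> expect_proc \<rho> (state_proc P r) (val 0 1 a b {})"
      unfolding expect_proc_def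
    proof (rule nn_integral_mono)
      fix z
      show "indicator (wrong r) z
        \<le> (case state_proc P r z of None \<Rightarrow> \<top> | Some (x, t) \<Rightarrow> val 0 1 a b {} x t)"
      proof (cases "z \<in> wrong r")
        case True
        then obtain Sh t where Sh: "state_proc P r z = Some (([], Sh), t)" "Sh \<noteq> S"
          by (auto simp: wrong_def)
        then have "bad Sh (items [])" by (auto simp: bad_def items_def)
        then show ?thesis using Sh True by (simp add: val_def)
      qed simp
    qed
    also have "\<dots> \<le> val 0 1 a b {} (P, {}) 0"
      using c0 c1 by (intro expect_state_proc_le[OF P]) simp_all
    also have "\<dots> = potential a b P" using S by (simp add: val_def bad_def)
    finally show ?thesis using x(1) by (rule order_trans)
  qed
  have "emeasure (noise \<rho>) (\<Union>r. wrong r) = (SUP r. emeasure (noise \<rho>) (wrong r))"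
    using wrong_sets by (intro SUP_emeasure_incseq[symmetric] inc) auto
  also have "\<dots> \<le> ennreal x" by (rule SUP_least) (rule wrong_le)
  finally have wrong: "emeasure (noise \<rho>) (\<Union>r. wrong r) \<le> ennreal x" .
  have cost_m: "(\<lambda>z. case ?run z of None \<Rightarrow> \<infinity> | Some (_, T) \<Rightarrow> ennreal (real T)) \<in> borel_measurable (noise \<rho>)"
    using measurable_compose[OF measurable_stopping[OF stopping_alg1_run[OF dk, of P], of \<rho>],
       of "\<lambda>x. case x of None \<Rightarrow> \<infinity> | Some (_, T) \<Rightarrow> ennreal (real T)" borel] by simp
  have "AE z in noise \<rho>. (case ?run z of None \<Rightarrow> \<infinity> | Some (_, T) \<Rightarrow> ennreal (real T)) \<noteq> \<infinity>"
    using fin by (intro nn_integral_PInf_AE[OF cost_m]) (simp add: alg1_expected_tests_def)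
  then have "AE z in noise \<rho>. z \<notin> ?run -` {None}"
    by eventually_elim (auto split: option.splits)
  then have none: "emeasure (noise \<rho>) (?run -` {None}) = 0"
    using AE_iff_measurable[OF run_sets[of "{None}"], of "\<lambda>z. z \<notin> ?run -` {None}"]
    by (simp only: space_noise not_not) blast
  define good where "good = ?run -` {Some (S, T) | T. True}"
  have good_sets: "good \<in> sets (noise \<rho>)" unfolding good_def by (rule run_sets)
  have "space (noise \<rho>) - good \<subseteq> (\<Union>r. wrong r) \<union> ?run -` {None}"
  proof
    fix z assume z: "z \<in> space (noise \<rho>) - good"
    show "z \<in> (\<Union>r. wrong r) \<union> ?run -` {None}"
    proof (cases "?run z")
      case (Some y)
      obtain Sh T where y: "y = (Sh, T)" by fastforce
      then obtain r where "state_proc P r z = Some (([], Sh), T)"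
        using Some alg1_run_eq_Some_iff[OF dk] by auto
      moreover have "Sh \<noteq> S" using z Some y by (auto simp: good_def)
      ultimately show ?thesis by (auto simp: wrong_def)
    qed simp
  qed
  then have "emeasure (noise \<rho>) (space (noise \<rho>) - good) \<le> emeasure (noise \<rho>) ((\<Union>r. wrong r) \<union> ?run -` {None})"
    using wrong_sets run_sets by (intro emeasure_mono) auto
  also have "\<dots> \<le> emeasure (noise \<rho>) (\<Union>r. wrong r) + emeasure (noise \<rho>) (?run -` {None})"
    using wrong_sets run_sets by (intro emeasure_subadditive) auto
  also have "\<dots> \<le> ennreal x" using wrong none by simp
  finally have "measure (noise \<rho>) (space (noise \<rho>) - good) \<le> x"
    using x(2) by (simp add: N.emeasure_eq_measure)
  then have "1 - x \<le> measure (noise \<rho>) good" using N.prob_compl[OF good_sets] by simp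
  also have "good = {z \<in> space (noise \<rho>). \<exists>T. ?run z = Some (S, T)}" by (auto simp: good_def)
  finally show ?thesis by (simp add: alg1_success_prob_def)
qed

lemma potential_eq:
  assumes "distinct (concat P)"
  shows "potential a b P = of_nat (length P) * a + of_nat (card (items P \<inter> S)) * b"
  using assms
proof (induction P)
  case Nil
  show ?case by (simp add: potential_def items_def)
next
  case (Cons p P)
  have "items (p # P) \<inter> S = (set p \<inter> S) \<union> (items P \<inter> S)" by (auto simp: items_def)
  moreover have "card ((set p \<inter> S) \<union> (items P \<inter> S)) = defects p + card (items P \<inter> S)"
    unfolding defects_def using Cons.prems finite_S
    by (intro card_Un_disjoint) (auto simp: items_def)
  ultimately have "card (items (p # P) \<inter> S) = defects p + card (items P \<inter> S)" by simp
  moreover have "potential a b (p # P) = a + b * of_nat (defects p) + potential a b P"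
    by (simp add: potential_def)
  ultimately show ?case using Cons by (simp add: distrib_left distrib_right add_ac mult_ac)
qed

lemma algorithm_bounds:
  assumes dk: "d = \<delta> / real k" and k: "1 \<le> k" and d4: "d \<le> 1/4" and W: "0 \<le> W" and reps: "1 \<le> reps"
    and P: "\<forall>p\<in>set P. proper p" "length P = k" "distinct (concat P)" and S: "S \<subseteq> items P" "card S = k"
  shows "1 - 3 * \<delta> \<le> alg1_success_prob \<rho> B k \<delta> P S"
    and "alg1_expected_tests \<rho> B k \<delta> P S \<le> ennreal (real k * (2 * real reps + (1 + d) * W) / (1 - d))"
proof -
  have pot: "potential (ennreal a) (ennreal b) P = ennreal (real k * (a + b))" if "0 \<le> a" "0 \<le> b" for a b
  proof -
    have "items P \<inter> S = S" using S by auto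
    then show ?thesis using that P(2) S(2)
      by (simp add: potential_eq[OF P(3)] ennreal_of_nat_eq_real_of_nat distrib_left
          ennreal_mult[symmetric] ennreal_plus[symmetric] del: ennreal_plus)
  qed
  \<comment> \<open>\<open>a\<close> and \<open>b\<close> solve the two balance conditions with
    equality for weights \<open>(1, 0)\<close>; \<open>a'\<close> and \<open>b'\<close> below do so
    for weights \<open>(0, 1)\<close>.\<close>
  define a where "a = (real reps + d * W) / (1 - d)"
  define b where "b = (real reps + W) / (1 - d)"
  have a: "0 \<le> a" and b: "0 \<le> b" using d W by (simp_all add: a_def b_def)
  have "alg1_expected_tests \<rho> B k \<delta> P S \<le> potential (ennreal a) (ennreal b) P"
  proof (rule expected_tests_le[OF dk reps P(1)])
    have "real reps + (W + a) * d = a" using d by (simp add: a_def field_simps)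
    then show "of_nat reps + (ennreal W + ennreal a) * ennreal d \<le> ennreal a"
      using a W d by (simp add: ennreal_of_nat_eq_real_of_nat ennreal_mult[symmetric] ennreal_plus[symmetric] del: ennreal_plus)
    have "real reps + (W + b * d) = b" using d by (simp add: b_def field_simps)
    then show "of_nat reps + (ennreal W + ennreal b * ennreal d) \<le> ennreal b"
      using b W d by (simp add: ennreal_of_nat_eq_real_of_nat ennreal_mult[symmetric] ennreal_plus[symmetric] del: ennreal_plus)
  qed
  also have "\<dots> = ennreal (real k * (a + b))" by (rule pot[OF a b])
  also have "real k * (a + b) = real k * (2 * real reps + (1 + d) * W) / (1 - d)"
    by (simp add: a_def b_def add_divide_distrib[symmetric] algebra_simps)
  finally show E: "alg1_expected_tests \<rho> B k \<delta> P S \<le> ennreal (real k * (2 * real reps + (1 + d) * W) / (1 - d))" .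
  define a' where "a' = d * d / (1 - d)"
  define b' where "b' = 2 * d / (1 - d)"
  have a': "0 \<le> a'" and b': "0 \<le> b'" using d by (simp_all add: a'_def b'_def)
  show "1 - 3 * \<delta> \<le> alg1_success_prob \<rho> B k \<delta> P S"
  proof (rule success_prob_ge[OF dk P(1) S(1)])
    show "alg1_expected_tests \<rho> B k \<delta> P S \<noteq> \<top>" using E by (auto simp: top_unique)
    have "(d + a') * d = a'" using d by (simp add: a'_def field_simps)
    then show "(ennreal d + ennreal a') * ennreal d \<le> ennreal a'"
      using a' d by (simp add: ennreal_mult[symmetric] ennreal_plus[symmetric] del: ennreal_plus)
    have "d + (d + b' * d) = b'" using d by (simp add: b'_def field_simps)
    then show "ennreal d + (ennreal d + ennreal b' * ennreal d) \<le> ennreal b'"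
      using b' d by (simp add: ennreal_mult[symmetric] ennreal_plus[symmetric] del: ennreal_plus)
    have dl: "real k * d = \<delta>" using dk k by simp
    \<comment> \<open>Equivalent to \<open>4 * d \<le> 1\<close> after cancelling \<open>d\<close>:
      the source of both the threshold 1/4 and the factor 3.\<close>
    have "d * (d + 2) \<le> d * (3 * (1 - d))" using d d4 by (intro mult_left_mono) auto
    then have "a' + b' \<le> 3 * d"
      using d by (simp add: a'_def b'_def add_divide_distrib[symmetric] pos_divide_le_eq algebra_simps)
    then have "real k * (a' + b') \<le> 3 * \<delta>"
      using mult_left_mono[of "a' + b'" "3 * d" "real k"] dl by simp
    then show "potential (ennreal a') (ennreal b') P \<le> ennreal (3 * \<delta>)"
      unfolding pot[OF a' b'] by (rule ennreal_leI)
    show "0 \<le> 3 * \<delta>" using dl d by (simp add: dl[symmetric])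
  qed
qed

end

subsection \<open>Asymptotics\<close>

text \<open>\<open>I_cap \<rho>\<close> is the relative entropy of a \<rho>-coin with respect to a
  fair coin. The bound \<open>ln y \<le> y - 1\<close> makes it nonnegative, and the bound is strict
  at \<open>1 / (2 * \<rho>)\<close>, which differs from 1.\<close>

lemma I_cap_pos:
  assumes "0 < \<rho>" "\<rho> < 1/2"
  shows "0 < I_cap \<rho>"
proof -
  have neq: "1 / (2 * \<rho>) \<noteq> 1" using assms by (simp add: field_simps)
  have "ln (1 / (2 * \<rho>)) \<le> 1 / (2 * \<rho>) - 1" using assms by (intro ln_le_minus_one) simp
  moreover have "ln (1 / (2 * \<rho>)) \<noteq> 1 / (2 * \<rho>) - 1"
    using neq ln_eq_minus_one[of "1 / (2 * \<rho>)"] assms by auto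
  ultimately have "\<rho> * ln (1 / (2 * \<rho>)) < \<rho> * (1 / (2 * \<rho>) - 1)"
    using assms by (intro mult_strict_left_mono) auto
  also have "\<rho> * (1 / (2 * \<rho>) - 1) = 1/2 - \<rho>" using assms by (simp add: field_simps)
  finally have 1: "\<rho> * ln (1 / (2 * \<rho>)) < 1/2 - \<rho>" .
  have "(1 - \<rho>) * ln (1 / (2 * (1 - \<rho>))) \<le> (1 - \<rho>) * (1 / (2 * (1 - \<rho>)) - 1)"
    using assms by (intro mult_left_mono ln_le_minus_one) auto
  also have "\<dots> = 1/2 - (1 - \<rho>)" using assms by (simp add: field_simps)
  finally have 2: "(1 - \<rho>) * ln (1 / (2 * (1 - \<rho>))) \<le> 1/2 - (1 - \<rho>)" .
  have ln2: "ln (1 / (2 * x)) = ln (1 / x) - ln 2" if "0 < x" for x :: real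
    using that by (simp add: ln_div ln_mult)
  have "\<rho> * ln (1 / (2 * \<rho>)) + (1 - \<rho>) * ln (1 / (2 * (1 - \<rho>)))
      = \<rho> * (ln (1 / \<rho>) - ln 2) + (1 - \<rho>) * (ln (1 / (1 - \<rho>)) - ln 2)"
    using assms ln2[of \<rho>] ln2[of "1 - \<rho>"] by simp
  also have "\<dots> = - I_cap \<rho>" by (simp add: I_cap_def H2_def algebra_simps)
  finally show ?thesis using 1 2 by linarith
qed

text \<open>The cost of an MNBS call relative to the ideal \<open>ln x\<close>, without its
  confidence term. The argument \<open>x + 1\<close> allows for rounding the partition size
  up.\<close>

lemma search_overhead_tendsto:
  fixes c :: real
  shows "((\<lambda>x. (ln (x + 1) + c * (max 0 (ln (ln (x + 1))) + 1)) / ln x) \<longlongrightarrow> 1) at_top"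
proof -
  have 1: "((\<lambda>x::real. ln (x + 1) / ln x) \<longlongrightarrow> 1) at_top" by real_asymp
  have 2: "((\<lambda>x::real. (ln (ln (x + 1)) + 1) / ln x) \<longlongrightarrow> 0) at_top" by real_asymp
  have 3: "((\<lambda>x. ln (x + 1) / ln x + c * ((ln (ln (x + 1)) + 1) / ln x)) \<longlongrightarrow> 1) at_top"
    using tendsto_add[OF 1 tendsto_mult_left[OF 2, of c]] by simp
  have "eventually (\<lambda>x::real. 0 \<le> ln (ln (x + 1))) at_top" by real_asymp
  then have "eventually (\<lambda>x::real. ln (x + 1) / ln x + c * ((ln (ln (x + 1)) + 1) / ln x)
      = (ln (x + 1) + c * (max 0 (ln (ln (x + 1))) + 1)) / ln x) at_top"
    by eventually_elim (simp add: add_divide_distrib max_def distrib_left)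
  then show ?thesis by (rule Lim_transform_eventually[OF 3])
qed


text \<open>At \<open>l = 1\<close> the inner logarithm is 0 and \<open>ln 0\<close> has the default
  value 0, so that case is separate; beyond it both inner logarithms are positive.\<close>

lemma log_log_mono:
  fixes l y :: real
  assumes "1 \<le> l" "l \<le> y"
  shows "max 0 (ln (ln l)) \<le> max 0 (ln (ln y))"
proof (cases "l = 1")
  case False
  then have "0 < ln l" using assms by simp
  moreover have "ln l \<le> ln y" using assms by simp
  ultimately have "ln (ln l) \<le> ln (ln y)" by (subst ln_le_cancel_iff) auto
  then show ?thesis by auto
qed simp

theorem theorem1:
  fixes \<rho> :: real
    and B :: "real \<Rightarrow> nat list \<Rightarrow> (nat, nat option) strat"
    and k :: "nat \<Rightarrow> nat"
    and \<delta> :: "nat \<Rightarrow> real"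
    and P :: "nat \<Rightarrow> nat list list"
  assumes "0 < \<rho>" and "\<rho> < 1/2"
    and "mnbs_spec \<rho> B"
    and "\<forall>\<^sub>F n in sequentially. 1 \<le> k n"
    and "(\<lambda>n. real (k n) / real n) \<longlonglongrightarrow> 0"
    and "\<forall>n. 0 < \<delta> n \<and> \<delta> n < 1"
    and "(\<lambda>n. \<delta> n / real (k n)) \<longlonglongrightarrow> 0"
    and "\<forall>n. even_split n (k n) (P n)"
  shows "\<exists>(\<epsilon>::nat \<Rightarrow> real) (C::real). \<epsilon> \<longlonglongrightarrow> 0 \<and>
    (\<forall>\<^sub>F n in sequentially. \<forall>S::nat set. S \<subseteq> {..<n} \<and> card S = k n \<longrightarrow>
        alg1_success_prob \<rho> B (k n) (\<delta> n) (P n) S \<ge> 1 - 3 * \<delta> n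
      \<and> alg1_expected_tests \<rho> B (k n) (\<delta> n) (P n) S
          \<le> ennreal ((real (k n) * ln (real n / real (k n)) / I_cap \<rho>) * (1 + \<epsilon> n)
                     + C * real (k n) * ln (real (k n) / \<delta> n)))"
proof -
  note rho = assms(1,2)
  define I where "I = I_cap \<rho>"
  define D where "D = D2 (1/2) \<rho>"
  have I: "0 < I" unfolding I_def by (rule I_cap_pos[OF rho])
  have D: "0 < D" unfolding D_def by (rule D2_half_pos[OF rho])
  obtain C where spec: "\<And>S \<delta>' xs. finite (S :: nat set) \<Longrightarrow> 0 < \<delta>' \<Longrightarrow> \<delta>' < 1 \<Longrightarrow> distinct xs \<Longrightarrow> xs \<noteq> [] \<Longrightarrow>
       1 - \<delta>' \<le> measure (noise \<rho>) {z \<in> space (noise \<rho>).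
           \<exists>t. strat_run S z (B \<delta>' xs) = Some (find (\<lambda>x. x \<in> S) xs, t)}
     \<and> (\<integral>\<^sup>+ z. (case strat_run S z (B \<delta>' xs) of None \<Rightarrow> \<infinity> | Some (_, t) \<Rightarrow> ennreal (real t)) \<partial>noise \<rho>)
         \<le> ennreal (ln (real (length xs)) / I + C * (ln (1 / \<delta>') + max 0 (ln (ln (real (length xs)))) + 1))"
    using assms(3) unfolding mnbs_spec_def I_def by blast
  \<comment> \<open>The constant in \<open>mnbs_spec\<close> may be negative; enlarging its other
    factor preserves the bound only with a nonnegative constant.\<close>
  define C0 where "C0 = max 0 C"
  have C0: "0 \<le> C0" "C \<le> C0" by (auto simp: C0_def)
  define x where "x n = real n / real (k n)" for n
  define d where "d n = \<delta> n / real (k n)" for n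
  \<comment> \<open>\<open>q\<close> absorbs the rounding and the log-log term of MNBS, and
    \<open>\<epsilon>\<close> also the factor \<open>(1 + d) / (1 - d)\<close> of the drift
    argument. In \<open>K\<close>, the first summand pays for the repetitions and the second for the
    confidence term of MNBS.\<close>
  define q where "q y = (ln (y + 1) + I * C0 * (max 0 (ln (ln (y + 1))) + 1)) / ln y" for y :: real
  define \<epsilon> where "\<epsilon> n = (1 + d n) / (1 - d n) * q (x n) - 1" for n
  define K where "K = 3 * (1 / D + 1) + 2 * C0"

  have d_lim: "d \<longlonglongrightarrow> 0" using assms(7) by (simp add: d_def[abs_def])
  have x_lim: "filterlim x at_top sequentially"
  proof -
    have "\<forall>\<^sub>F n in sequentially. 0 < real (k n) / real n"
      using assms(4) eventually_gt_at_top[of 0] by eventually_elim simp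
    from filterlim_inverse_at_top[OF assms(5) this] show ?thesis by (simp add: x_def[abs_def])
  qed
  have "\<epsilon> \<longlonglongrightarrow> (1 + 0) / (1 - 0) * 1 - 1"
    unfolding \<epsilon>_def q_def
    by (intro tendsto_intros d_lim filterlim_compose[OF search_overhead_tendsto x_lim]) simp
  then have eps: "\<epsilon> \<longlonglongrightarrow> 0" by simp

  have "\<forall>\<^sub>F n in sequentially. d n < 1/4" by (rule order_tendstoD(2)[OF d_lim]) simp
  moreover have "\<forall>\<^sub>F n in sequentially. 2 \<le> x n"
    using x_lim by (simp add: filterlim_at_top)
  ultimately have "\<forall>\<^sub>F n in sequentially. \<forall>S::nat set. S \<subseteq> {..<n} \<and> card S = k n \<longrightarrow>
        alg1_success_prob \<rho> B (k n) (\<delta> n) (P n) S \<ge> 1 - 3 * \<delta> n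
      \<and> alg1_expected_tests \<rho> B (k n) (\<delta> n) (P n) S
          \<le> ennreal ((real (k n) * ln (real n / real (k n)) / I_cap \<rho>) * (1 + \<epsilon> n)
                     + K * real (k n) * ln (real (k n) / \<delta> n))"
    using assms(4)
  proof eventually_elim
    case (elim n)
    have k: "1 \<le> k n" and d4: "d n < 1/4" and x2: "2 \<le> x n" using elim by auto
    have d0: "0 < d n" using assms(6) k by (simp add: d_def)
    define L where "L = ln (real (k n) / \<delta> n)"
    have Ld: "ln (1 / d n) = L" by (simp add: L_def d_def)
    \<comment> \<open>From \<open>1 / d n > 4 > exp 1\<close>. It lets a multiple of
      \<open>L\<close> absorb the rounding in \<open>rep_count\<close>.\<close>
    have L: "1 \<le> L"
    proof -
      have "(3::real) \<le> 1 / d n" using d4 d0 by (simp add: field_simps)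
      then have "exp 1 \<le> 1 / d n" using exp_le by linarith
      then show ?thesis unfolding Ld[symmetric] using d0 by (subst ln_ge_iff) auto
    qed
    \<comment> \<open>\<open>m\<close> is n / k rounded up, hence the largest partition size in
      \<open>even_split\<close>.\<close>
    define m where "m = (n + k n - 1) div k n"
    have mx: "real m \<le> x n + 1"
    proof -
      have "real m \<le> real (n + k n - 1) / real (k n)" unfolding m_def by (rule of_nat_div_le_of_nat)
      also have "\<dots> \<le> (real n + real (k n)) / real (k n)" by (intro divide_right_mono) auto
      also have "\<dots> = x n + 1" using k by (simp add: x_def add_divide_distrib)
      finally show ?thesis .
    qed
    define W where "W = ln (x n + 1) / I + C0 * (L + max 0 (ln (ln (x n + 1))) + 1)"
    have W: "0 \<le> W" unfolding W_def using x2 I C0 L by (intro add_nonneg_nonneg mult_nonneg_nonneg) auto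
    have split: "length (P n) = k n" "distinct (concat (P n))" "set (concat (P n)) = {..<n}"
      "\<forall>p\<in>set (P n). length p = n div k n \<or> length p = m"
      using assms(8) unfolding even_split_def m_def by auto
    \<comment> \<open>This keeps the initial partitions nonempty, as \<open>proper\<close>
      demands.\<close>
    have kn: "k n \<le> n"
    proof -
      have "2 * real (k n) \<le> real n" using x2 k by (simp add: x_def field_simps)
      then show ?thesis by linarith
    qed
    have div: "1 \<le> n div k n" using kn k by (simp add: Suc_le_eq div_greater_zero_iff)
    have div_m: "n div k n \<le> m" unfolding m_def using k by (intro div_le_mono) simp
    define N where "N = rep_count \<rho> (d n)"
    have N: "1 \<le> N" "real N \<le> L / D + 1"
    proof -
      have pos: "0 < L / D" using L D by simp
      then have "0 < \<lceil>L / D\<rceil>" by simp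
      then show "1 \<le> N" unfolding N_def rep_count_def Ld D_def[symmetric] by linarith
      show "real N \<le> L / D + 1"
        unfolding N_def rep_count_def Ld D_def[symmetric] using pos by linarith
    qed
    show ?case
    proof (intro allI impI)
      fix S :: "nat set" assume S: "S \<subseteq> {..<n} \<and> card S = k n"
      then have finS: "finite S" using finite_subset by blast
      interpret noisy_testing \<rho> S B "d n" m W
      proof
        show "0 < \<rho>" "\<rho> < 1/2" "finite S" "0 < d n" "d n < 1" using rho finS d0 d4 by auto
        fix xs :: "nat list" assume xs: "distinct xs" "xs \<noteq> []"
        note sp = spec[OF finS d0 _ xs]
        show "1 - d n \<le> measure (noise \<rho>) {z \<in> space (noise \<rho>).
          \<exists>t. strat_run S z (B (d n) xs) = Some (find (\<lambda>x. x \<in> S) xs, t)}"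
          using sp d4 by simp
        assume len: "length xs \<le> m"
        have l: "1 \<le> real (length xs)" "real (length xs) \<le> x n + 1"
          using xs len mx by (auto simp: Suc_le_eq)
        have "ln (real (length xs)) \<le> ln (x n + 1)"
          by (rule ln_mono) (use l in linarith)+
        then have "ln (real (length xs)) / I \<le> ln (x n + 1) / I"
          using I by (intro divide_right_mono) simp_all
        moreover have "C * (L + max 0 (ln (ln (real (length xs)))) + 1) \<le> C0 * (L + max 0 (ln (ln (x n + 1))) + 1)"
          using C0 L log_log_mono[OF l] by (intro mult_mono) auto
        ultimately have "ln (real (length xs)) / I + C * (ln (1 / d n) + max 0 (ln (ln (real (length xs)))) + 1) \<le> W"
          unfolding Ld W_def by (rule add_mono)
        then show "(\<integral>\<^sup>+ z. (case strat_run S z (B (d n) xs) of None \<Rightarrow> \<infinity> | Some (_, t) \<Rightarrow> ennreal (real t)) \<partial>noise \<rho>)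
          \<le> ennreal W"
          using sp d4 by (intro order_trans[OF conjunct2[OF sp] ennreal_leI]) auto
      qed
      have proper: "\<forall>p\<in>set (P n). proper p"
      proof
        fix p assume p: "p \<in> set (P n)"
        have "distinct p" using split(2) p by (simp add: distinct_concat_iff)
        moreover have "length p = n div k n \<or> length p = m" using split(4) p by blast
        ultimately show "proper p" using div div_m unfolding proper_def by auto
      qed
      have items: "S \<subseteq> items (P n)" using S split(3) by (auto simp: items_def)
      note bounds = algorithm_bounds[OF d_def k less_imp_le[OF d4] W N(1)[unfolded N_def] proper split(1,2) items]
      have "real (k n) * (2 * real N + (1 + d n) * W) / (1 - d n)
         \<le> (real (k n) * ln (x n) / I) * (1 + \<epsilon> n) + K * real (k n) * L"
      proof -
        define g where "g = (1 + d n) / (1 - d n)"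
        have g: "0 \<le> g" "g \<le> 2" using d0 d4 by (auto simp: g_def field_simps)
        \<comment> \<open>The confidence part \<open>C0 * L\<close> is set aside for the O-term; the
          rest is a multiple of \<open>ln (x n)\<close>, which is positive because
          \<open>2 \<le> x n\<close>.\<close>
        have W_split: "W = ln (x n) / I * q (x n) + C0 * L"
          using x2 I by (simp add: W_def q_def field_simps)
        have "2 * real N / (1 - d n) \<le> 3 * real N"
        proof -
          have "2 * real N \<le> 3 * real N * (1 - d n)"
            using mult_left_mono[of "2/3" "1 - d n" "3 * real N"] d4 by simp
          then show ?thesis using d4 by (simp add: pos_divide_le_eq)
        qed
        also have "\<dots> \<le> 3 * ((1 / D + 1) * L)"
        proof -
          have "(1 / D + 1) * L = L / D + L" by (simp add: distrib_right)
          then show ?thesis using N(2) L by linarith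
        qed
        finally have 1: "2 * real N / (1 - d n) \<le> 3 * ((1 / D + 1) * L)" .
        have "g * W = ln (x n) / I * (g * q (x n)) + g * (C0 * L)"
          unfolding W_split by (simp add: algebra_simps)
        also have "\<dots> \<le> ln (x n) / I * (g * q (x n)) + 2 * (C0 * L)"
          using g C0 L by (intro add_left_mono mult_right_mono) auto
        also have "g * q (x n) = 1 + \<epsilon> n" by (simp add: \<epsilon>_def g_def)
        finally have 2: "g * W \<le> ln (x n) / I * (1 + \<epsilon> n) + 2 * (C0 * L)" .
        have "real (k n) * (2 * real N + (1 + d n) * W) / (1 - d n)
            = real (k n) * (2 * real N / (1 - d n) + g * W)"
          by (simp add: g_def add_divide_distrib[symmetric])
        also have "\<dots> \<le> real (k n) * (3 * ((1 / D + 1) * L) + (ln (x n) / I * (1 + \<epsilon> n) + 2 * (C0 * L)))"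
          using 1 2 by (intro mult_left_mono add_mono) auto
        also have "\<dots> = (real (k n) * ln (x n) / I) * (1 + \<epsilon> n) + K * real (k n) * L"
          by (simp add: K_def algebra_simps)
        finally show ?thesis .
      qed
      then have "alg1_expected_tests \<rho> B (k n) (\<delta> n) (P n) S
          \<le> ennreal ((real (k n) * ln (x n) / I) * (1 + \<epsilon> n) + K * real (k n) * L)"
        using bounds(2) S unfolding N_def[symmetric] by (meson ennreal_leI order_trans)
      then show "1 - 3 * \<delta> n \<le> alg1_success_prob \<rho> B (k n) (\<delta> n) (P n) S
        \<and> alg1_expected_tests \<rho> B (k n) (\<delta> n) (P n) S
          \<le> ennreal ((real (k n) * ln (real n / real (k n)) / I_cap \<rho>) * (1 + \<epsilon> n)
                     + K * real (k n) * ln (real (k n) / \<delta> n))"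
        using bounds(1) S unfolding x_def I_def L_def by blast
    qed
  qed
  with eps show ?thesis by blast
qed

end
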